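(* Let $0<\gamma<1$. For every $\alpha\in[-\pi,\pi]$ the map $\varphi\mapsto\mathcal{K}_2\varphi(\alpha)$ is a bounded linear functional on $L^1(\mathbb{R}_+)\hat\otimes_\pi\Lambda_\gamma^e$, and its norm does not exceed $$c_\gamma=\gamma^{-1}\pi^{\gamma-1}+\|\mathcal{H}\|_{\Lambda_\gamma\to\Lambda_\gamma}(2\pi)^\gamma .$$
   Context: $\Lambda_\gamma$ is the Hölder space of $2\pi$-periodic functions on $\mathbb{R}$ with exponent $\gamma$, with the semi-norm $\|\phi\|_{\Lambda_\gamma}=\sup_{s\ne t}|\phi(s)-\phi(t)|/|s-t|^\gamma$; $\Lambda_\gamma^e$ is the subspace of even functions in $\Lambda_\gamma$. $X\hat\otimes_\pi Y$ denotes the completion of the algebraic tensor product $X\otimes Y$ in the projective (semi-)norm $\|u\|_\pi=\inf\{\sum_{i=1}^n\|x_i\|\|y_i\| : u=\sum_{i=1}^n x_i\otimes y_i\}$, here formed with the $L^1$ norm and the semi-norm $\|\cdot\|_{\Lambda_\gamma}$. $\mathcal{H}$ is the periodic Hilbert transform $\mathcal{H}\phi(\alpha)=\frac1{2\pi}\int_{-\pi}^{\pi}\frac{\phi(\alpha-t)}{\tan(t/2)}dt$ (principal value), which by Privalov's theorem is bounded on $\Lambda_\gamma$; $\|\mathcal{H}\|_{\Lambda_\gamma\to\Lambda_\gamma}$ is its operator norm with respect to the semi-norm $\|\cdot\|_{\Lambda_\gamma}$. The operator $\mathcal{K}_2$ is formally $$\mathcal{K}_2\varphi(\alpha)=\frac1\pi\int_0^\infty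 d\rho\int_{-\pi}^{\pi}\frac{\varphi(\rho,\theta)}{\sin(\theta-\alpha)}d\theta .$$ The inner integral is a principal value, i.e. after the substitution $t=\alpha-\theta$ (using $2\pi$-periodicity in $\theta$) it is taken as $\lim_{\varepsilon\to0+}\left(\int_{-\pi+\varepsilon}^{-\varepsilon}+\int_{\varepsilon}^{\pi-\varepsilon}\right)$ in the variable $t$. On elementary tensors $$\mathcal{K}_2(\varphi_1\otimes\varphi_2)(\alpha)=\left(\int_0^\infty\varphi_1(\rho)d\rho\right)\left(\frac1\pi\int_{-\pi}^{\pi}\frac{\varphi_2(\theta)}{\sin(\theta-\alpha)}d\theta\right),$$ extended linearly to the algebraic tensor product, and on the projective tensor product it is understood as the extension by continuity. *)

theory Defs
  imports "HOL-Analysis.Analysis"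
begin

section \<open>Seminormed spaces with explicit carriers\<close>

text \<open>Carriers are explicit because the Hoelder spaces depend on a real parameter and the elements of
  quotients and completions are equivalence classes.  The scalar field is the type \<open>'k\<close>, to be
  instantiated with the real or the complex numbers; the zero vector is \<open>0\<close> times any vector.\<close>

record ('k, 'v) seminormed_space =
  vcarrier :: "'v set"
  vadd :: "'v \<Rightarrow> 'v \<Rightarrow> 'v"
  vsmult :: "'k \<Rightarrow> 'v \<Rightarrow> 'v"
  seminorm :: "'v \<Rightarrow> real"

definition vdiff :: "('k::ring_1, 'v) seminormed_space \<Rightarrow> 'v \<Rightarrow> 'v \<Rightarrow> 'v" where
  "vdiff V v w = vadd V v (vsmult V (- 1) w)"

definition scalars :: "('k::real_normed_field, 'k) seminormed_space" where
  "scalars = \<lparr>vcarrier = UNIV, vadd = (+), vsmult = (*), seminorm = norm\<rparr>"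

definition bounded_linear_map ::
  "('k, 'v) seminormed_space \<Rightarrow> ('k, 'w) seminormed_space \<Rightarrow> ('v \<Rightarrow> 'w) \<Rightarrow> bool" where
  "bounded_linear_map V W T \<longleftrightarrow>
     (\<forall>v\<in>vcarrier V. T v \<in> vcarrier W) \<and>
     (\<forall>v\<in>vcarrier V. \<forall>w\<in>vcarrier V. T (vadd V v w) = vadd W (T v) (T w)) \<and>
     (\<forall>c. \<forall>v\<in>vcarrier V. T (vsmult V c v) = vsmult W c (T v)) \<and>
     (\<exists>C. \<forall>v\<in>vcarrier V. seminorm W (T v) \<le> C * seminorm V v)"

abbreviation bounded_linear_functional ::
  "('k::real_normed_field, 'v) seminormed_space \<Rightarrow> ('v \<Rightarrow> 'k) \<Rightarrow> bool" where
  "bounded_linear_functional V \<equiv> bounded_linear_map V scalars"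

text \<open>A supremum of reals, hence meaningful for bounded maps only.\<close>

definition op_norm ::
  "('k, 'v) seminormed_space \<Rightarrow> ('k, 'w) seminormed_space \<Rightarrow> ('v \<Rightarrow> 'w) \<Rightarrow> real" where
  "op_norm V W T = Sup {seminorm W (T v) | v. v \<in> vcarrier V \<and> seminorm V v \<le> 1}"

subsection \<open>Quotient by the kernel of the seminorm, and completion\<close>

definition null_class :: "('k::ring_1, 'v) seminormed_space \<Rightarrow> 'v \<Rightarrow> 'v set" where
  "null_class V v = {w \<in> vcarrier V. seminorm V (vdiff V v w) = 0}"

definition null_quotient ::
  "('k::ring_1, 'v) seminormed_space \<Rightarrow> ('k, 'v set) seminormed_space" where
  "null_quotient V =
     \<lparr>vcarrier = null_class V ` vcarrier V,
      vadd = (\<lambda>A B. \<Union>v\<in>A. \<Union>w\<in>B. null_class V (vadd V v w)),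
      vsmult = (\<lambda>c A. \<Union>v\<in>A. null_class V (vsmult V c v)),
      seminorm = (\<lambda>A. seminorm V (SOME v. v \<in> A))\<rparr>"

definition cauchy_sequences ::
  "('k::ring_1, 'v) seminormed_space \<Rightarrow> ('k, nat \<Rightarrow> 'v) seminormed_space" where
  "cauchy_sequences V =
     \<lparr>vcarrier = {s. (\<forall>n. s n \<in> vcarrier V) \<and>
        (\<forall>e>0. \<exists>N. \<forall>m\<ge>N. \<forall>n\<ge>N. seminorm V (vdiff V (s m) (s n)) < e)},
      vadd = (\<lambda>s t n. vadd V (s n) (t n)),
      vsmult = (\<lambda>c s n. vsmult V c (s n)),
      seminorm = (\<lambda>s. lim (\<lambda>n. seminorm V (s n)))\<rparr>"

definition sn_completion ::
  "('k::ring_1, 'v) seminormed_space \<Rightarrow> ('k, (nat \<Rightarrow> 'v) set) seminormed_space" where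
  "sn_completion V = null_quotient (cauchy_sequences V)"

definition to_completion :: "('k::ring_1, 'v) seminormed_space \<Rightarrow> 'v \<Rightarrow> (nat \<Rightarrow> 'v) set" where
  "to_completion V v = null_class (cauchy_sequences V) (\<lambda>_. v)"

text \<open>Extension by continuity of a functional to the completion: its value at a class of Cauchy
  sequences is the common limit along all representatives.\<close>

definition extend_by_continuity ::
  "('v \<Rightarrow> 'k::real_normed_field) \<Rightarrow> (nat \<Rightarrow> 'v) set \<Rightarrow> 'k" where
  "extend_by_continuity F z = (THE l. \<forall>s\<in>z. (\<lambda>n. F (s n)) \<longlonglongrightarrow> l)"


section \<open>The projective tensor product\<close>

definition bilinear_form ::
  "('k::field, 'x) seminormed_space \<Rightarrow> ('k, 'y) seminormed_space \<Rightarrow> ('x \<Rightarrow> 'y \<Rightarrow> 'k) \<Rightarrow> bool" where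
  "bilinear_form X Y b \<longleftrightarrow>
     (\<forall>x\<in>vcarrier X. \<forall>x'\<in>vcarrier X. \<forall>y\<in>vcarrier Y. b (vadd X x x') y = b x y + b x' y) \<and>
     (\<forall>x\<in>vcarrier X. \<forall>y\<in>vcarrier Y. \<forall>y'\<in>vcarrier Y. b x (vadd Y y y') = b x y + b x y') \<and>
     (\<forall>c. \<forall>x\<in>vcarrier X. \<forall>y\<in>vcarrier Y. b (vsmult X c x) y = c * b x y) \<and>
     (\<forall>c. \<forall>x\<in>vcarrier X. \<forall>y\<in>vcarrier Y. b x (vsmult Y c y) = c * b x y)"

text \<open>Following Ryan (Introduction to Tensor Products of Banach Spaces, Section 1.1), the algebraic
  tensor product is the span, inside the linear functionals on the space of all (not necessarily
  bounded) bilinear forms, of the evaluations \<open>b \<mapsto> b x y\<close>.  The value \<open>0\<close> outside the bilinear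
  forms is a dummy.  Scalars are absorbed into the factors, so the span is the set of finite sums.\<close>

type_synonym ('k, 'x, 'y) tensor = "('x \<Rightarrow> 'y \<Rightarrow> 'k) \<Rightarrow> 'k"

definition elem_tensor ::
  "('k::field, 'x) seminormed_space \<Rightarrow> ('k, 'y) seminormed_space \<Rightarrow> 'x \<Rightarrow> 'y \<Rightarrow> ('k, 'x, 'y) tensor" where
  "elem_tensor X Y x y = (\<lambda>b. if bilinear_form X Y b then b x y else 0)"

definition represents ::
  "('k::field, 'x) seminormed_space \<Rightarrow> ('k, 'y) seminormed_space \<Rightarrow>
     ('x \<times> 'y) list \<Rightarrow> ('k, 'x, 'y) tensor \<Rightarrow> bool" where
  "represents X Y ps u \<longleftrightarrow> set ps \<subseteq> vcarrier X \<times> vcarrier Y \<and>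
     u = (\<lambda>b. \<Sum>(x, y)\<leftarrow>ps. elem_tensor X Y x y b)"

definition alg_tensor ::
  "('k::field, 'x) seminormed_space \<Rightarrow> ('k, 'y) seminormed_space \<Rightarrow>
     ('k, ('k, 'x, 'y) tensor) seminormed_space" where
  "alg_tensor X Y =
     \<lparr>vcarrier = {u. \<exists>ps. represents X Y ps u},
      vadd = (\<lambda>u v b. u b + v b),
      vsmult = (\<lambda>c u b. c * u b),
      seminorm = (\<lambda>u. Inf {(\<Sum>(x, y)\<leftarrow>ps. seminorm X x * seminorm Y y) | ps. represents X Y ps u})\<rparr>"

definition extend_linearly ::
  "('k::field, 'x) seminormed_space \<Rightarrow> ('k, 'y) seminormed_space \<Rightarrow>
     ('x \<Rightarrow> 'y \<Rightarrow> 'k) \<Rightarrow> ('k, 'x, 'y) tensor \<Rightarrow> 'k" where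
  "extend_linearly X Y f u = (THE c. \<forall>ps. represents X Y ps u \<longrightarrow> (\<Sum>(x, y)\<leftarrow>ps. f x y) = c)"

definition proj_tensor ::
  "('k::field, 'x) seminormed_space \<Rightarrow> ('k, 'y) seminormed_space \<Rightarrow>
     ('k, (nat \<Rightarrow> ('k, 'x, 'y) tensor) set) seminormed_space" where
  "proj_tensor X Y = sn_completion (alg_tensor X Y)"


section \<open>The function spaces\<close>

definition integrable_functions ::
  "('k::{real_normed_field, banach, second_countable_topology}, real \<Rightarrow> 'k) seminormed_space" where
  "integrable_functions =
     \<lparr>vcarrier = {f. integrable (lebesgue_on {0..}) f},
      vadd = (\<lambda>f g x. f x + g x),
      vsmult = (\<lambda>c f x. c * f x),
      seminorm = (\<lambda>f. \<integral>x. norm (f x) \<partial>lebesgue_on {0..})\<rparr>"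

definition L1 ::
  "('k::{real_normed_field, banach, second_countable_topology}, (real \<Rightarrow> 'k) set) seminormed_space" where
  "L1 = null_quotient integrable_functions"

definition L1_integral ::
  "(real \<Rightarrow> 'k::{real_normed_field, banach, second_countable_topology}) set \<Rightarrow> 'k" where
  "L1_integral A = (\<integral>x. (SOME f. f \<in> A) x \<partial>lebesgue_on {0..})"

definition holder_quotients :: "real \<Rightarrow> (real \<Rightarrow> 'k::real_normed_field) \<Rightarrow> real set" where
  "holder_quotients \<gamma> \<phi> = {norm (\<phi> s - \<phi> t) / \<bar>s - t\<bar> powr \<gamma> | s t. s \<noteq> t}"

definition holder_space :: "real \<Rightarrow> ('k::real_normed_field, real \<Rightarrow> 'k) seminormed_space" where
  "holder_space \<gamma> =
     \<lparr>vcarrier = {\<phi>. (\<forall>x. \<phi> (x + 2 * pi) = \<phi> x) \<and> bdd_above (holder_quotients \<gamma> \<phi>)},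
      vadd = (\<lambda>\<phi> \<psi> x. \<phi> x + \<psi> x),
      vsmult = (\<lambda>c \<phi> x. c * \<phi> x),
      seminorm = (\<lambda>\<phi>. Sup (holder_quotients \<gamma> \<phi>))\<rparr>"

definition holder_even :: "real \<Rightarrow> ('k::real_normed_field, real \<Rightarrow> 'k) seminormed_space" where
  "holder_even \<gamma> =
     (holder_space \<gamma>)\<lparr>vcarrier := {\<phi> \<in> vcarrier (holder_space \<gamma>). \<forall>x. \<phi> (- x) = \<phi> x}\<rparr>"


section \<open>The operators\<close>

definition hilbert_transform ::
  "(real \<Rightarrow> 'k::{real_normed_field, banach, second_countable_topology}) \<Rightarrow> real \<Rightarrow> 'k" where
  "hilbert_transform \<phi> \<alpha> =
     Lim (at_right 0) (\<lambda>\<epsilon>. (LBINT t:{-pi..-\<epsilon>}. \<phi> (\<alpha> - t) /\<^sub>R tan (t / 2)) +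
                           (LBINT t:{\<epsilon>..pi}. \<phi> (\<alpha> - t) /\<^sub>R tan (t / 2))) /\<^sub>R (2 * pi)"

text \<open>Truncations of \<open>\<integral> \<phi> \<theta> / sin (\<theta> - \<alpha>) d\<theta>\<close> after the substitution \<open>t = \<alpha> - \<theta>\<close>.\<close>

definition truncated_sin_integral ::
  "(real \<Rightarrow> 'k::{real_normed_field, banach, second_countable_topology}) \<Rightarrow> real \<Rightarrow> real \<Rightarrow> 'k" where
  "truncated_sin_integral \<phi> \<alpha> \<epsilon> =
     (LBINT t:{-pi + \<epsilon>..-\<epsilon>}. \<phi> (\<alpha> - t) /\<^sub>R sin (- t)) +
     (LBINT t:{\<epsilon>..pi - \<epsilon>}. \<phi> (\<alpha> - t) /\<^sub>R sin (- t))"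

definition K2_elem ::
  "real \<Rightarrow> (real \<Rightarrow> 'k::{real_normed_field, banach, second_countable_topology}) set \<Rightarrow>
     (real \<Rightarrow> 'k) \<Rightarrow> 'k" where
  "K2_elem \<alpha> A \<phi> = L1_integral A * (Lim (at_right 0) (truncated_sin_integral \<phi> \<alpha>) /\<^sub>R pi)"

text \<open>\<open>K2 \<gamma> \<phi> \<alpha>\<close> depends on \<open>\<gamma>\<close> only through its domain.\<close>

definition K2 ::
  "real \<Rightarrow> (nat \<Rightarrow> ('k::{real_normed_field, banach, second_countable_topology},
       (real \<Rightarrow> 'k) set, real \<Rightarrow> 'k) tensor) set \<Rightarrow> real \<Rightarrow> 'k" where
  "K2 \<gamma> \<phi> \<alpha> = extend_by_continuity (extend_linearly L1 (holder_even \<gamma>) (K2_elem \<alpha>)) \<phi>"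

end

theory Submission
  imports Defs
begin

text \<open>Since \<open>2 / sin t = cot (t / 2) - cot ((t - \<pi>) / 2)\<close>, the singular integral in the angular variable
  is a difference of two values of the periodic Hilbert transform:
  \<open>\<K>\<^sub>2 (\<phi>\<^sub>1 \<otimes> \<phi>\<^sub>2) \<alpha> = (\<integral> \<phi>\<^sub>1) (\<H> \<phi>\<^sub>2 (\<alpha> - \<pi>) - \<H> \<phi>\<^sub>2 \<alpha>)\<close>.
  By Privalov's theorem this is at most \<open>\<parallel>\<phi>\<^sub>1\<parallel> \<parallel>\<H>\<parallel> \<parallel>\<phi>\<^sub>2\<parallel> \<pi>\<^sup>\<gamma>\<close>, so the linear extension to tensors is
  bounded by \<open>\<parallel>\<H>\<parallel> \<pi>\<^sup>\<gamma> \<le> c\<^sub>\<gamma>\<close> in the projective norm, and the bound passes to the completion.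
  Privalov's theorem is needed for the operator norm, a supremum, to be meaningful.\<close>

section \<open>Seminormed spaces\<close>

text \<open>The angular kernel is singular at t = 0 and also at t = pi and t = - pi. Writing inverse
  (sin t) through cot (t / 2) and tan (t / 2) separates these singularities. A shift by pi turns the
  tangent into a cotangent and exchanges the intervals [- pi + \<epsilon>, - \<epsilon>] and
  [\<epsilon>, pi - \<epsilon>], so the reduction to cotangent kernels is an exact identity for each
  \<epsilon>, before any limit. Principal values then disappear: the cotangent is odd, so \<phi>
  \<alpha> may be subtracted under symmetric truncations, and the Hoelder condition makes the result
  absolutely convergent. The other difficulty is that \<open>Lim\<close>, \<open>lim\<close>,
  \<open>THE\<close>, \<open>SOME\<close>, \<open>Sup\<close> and \<open>Inf\<close> are total: each
  carries information only once existence, uniqueness, boundedness or nonemptiness is known. Much of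
  the abstract part supplies exactly this, with one explicit constant carried from elementary
  tensors to the completion.\<close>

locale seminormed_vector_space =
  fixes V :: "('k::real_normed_field, 'v) seminormed_space"
  assumes add_closed: "v \<in> vcarrier V \<Longrightarrow> w \<in> vcarrier V \<Longrightarrow> vadd V v w \<in> vcarrier V"
    and smult_closed: "v \<in> vcarrier V \<Longrightarrow> vsmult V c v \<in> vcarrier V"
    and add_assoc: "u \<in> vcarrier V \<Longrightarrow> v \<in> vcarrier V \<Longrightarrow> w \<in> vcarrier V \<Longrightarrow>
      vadd V (vadd V u v) w = vadd V u (vadd V v w)"
    and add_commute: "v \<in> vcarrier V \<Longrightarrow> w \<in> vcarrier V \<Longrightarrow> vadd V v w = vadd V w v"
    and smult_add: "v \<in> vcarrier V \<Longrightarrow> w \<in> vcarrier V \<Longrightarrow>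
      vsmult V c (vadd V v w) = vadd V (vsmult V c v) (vsmult V c w)"
    and add_smult: "v \<in> vcarrier V \<Longrightarrow>
      vsmult V (c + d) v = vadd V (vsmult V c v) (vsmult V d v)"
    and smult_smult: "v \<in> vcarrier V \<Longrightarrow> vsmult V c (vsmult V d v) = vsmult V (c * d) v"
    and smult_one: "v \<in> vcarrier V \<Longrightarrow> vsmult V 1 v = v"
    and zero_add: "v \<in> vcarrier V \<Longrightarrow> w \<in> vcarrier V \<Longrightarrow> vadd V (vsmult V 0 v) w = w"
    and triangle: "v \<in> vcarrier V \<Longrightarrow> w \<in> vcarrier V \<Longrightarrow>
      seminorm V (vadd V v w) \<le> seminorm V v + seminorm V w"
    and homogeneous: "v \<in> vcarrier V \<Longrightarrow> seminorm V (vsmult V c v) = norm c * seminorm V v"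
begin

lemma diff_closed: "v \<in> vcarrier V \<Longrightarrow> w \<in> vcarrier V \<Longrightarrow> vdiff V v w \<in> vcarrier V"
  by (simp add: vdiff_def add_closed smult_closed)

lemma diff_self: "v \<in> vcarrier V \<Longrightarrow> vdiff V v v = vsmult V 0 v"
  using add_smult[of v 1 "- 1"] by (simp add: vdiff_def smult_one)

text \<open>The vector v - v has seminorm 0, and the triangle inequality bounds it by twice the
  seminorm of v.\<close>

lemma seminorm_nonneg: "v \<in> vcarrier V \<Longrightarrow> 0 \<le> seminorm V v"
  using triangle[of v "vsmult V (- 1) v"] homogeneous[of v 0] homogeneous[of v "- 1"] diff_self[of v]
  by (simp add: vdiff_def smult_closed)

lemma seminorm_diff_self: "v \<in> vcarrier V \<Longrightarrow> seminorm V (vdiff V v v) = 0"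
  by (simp add: diff_self homogeneous)

lemma seminorm_diff_commute:
  assumes "v \<in> vcarrier V" "w \<in> vcarrier V"
  shows "seminorm V (vdiff V v w) = seminorm V (vdiff V w v)"
proof -
  have "vsmult V (- 1) (vdiff V v w) = vdiff V w v"
    using assms by (simp add: vdiff_def smult_add smult_closed smult_smult smult_one add_commute)
  then show ?thesis
    using homogeneous[OF diff_closed[OF assms], of "- 1"] by simp
qed

lemma add_left_commute:
  "u \<in> vcarrier V \<Longrightarrow> v \<in> vcarrier V \<Longrightarrow> w \<in> vcarrier V \<Longrightarrow>
    vadd V u (vadd V v w) = vadd V v (vadd V u w)"
  by (metis add_assoc add_commute)

lemma diff_add_diff:
  assumes "u \<in> vcarrier V" "v \<in> vcarrier V" "w \<in> vcarrier V"
  shows "vadd V (vdiff V u v) (vdiff V v w) = vdiff V u w"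
proof -
  have "vadd V (vsmult V (- 1) v) (vadd V v (vsmult V (- 1) w))
      = vadd V (vdiff V v v) (vsmult V (- 1) w)"
    using assms by (simp add: vdiff_def add_assoc[symmetric] smult_closed add_commute)
  then show ?thesis
    using assms by (simp add: diff_self zero_add smult_closed)
      (simp add: vdiff_def add_assoc smult_closed add_closed)
qed

lemma seminorm_diff_triangle:
  assumes "u \<in> vcarrier V" "v \<in> vcarrier V" "w \<in> vcarrier V"
  shows "seminorm V (vdiff V u w) \<le> seminorm V (vdiff V u v) + seminorm V (vdiff V v w)"
  using assms triangle[of "vdiff V u v" "vdiff V v w"] by (simp add: diff_add_diff diff_closed)

lemma diff_of_sums:
  assumes "v \<in> vcarrier V" "w \<in> vcarrier V" "v' \<in> vcarrier V" "w' \<in> vcarrier V"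
  shows "vdiff V (vadd V v w) (vadd V v' w') = vadd V (vdiff V v v') (vdiff V w w')"
  using assms by (simp add: vdiff_def smult_add add_closed smult_closed add_assoc add_left_commute)

lemma diff_of_multiples:
  assumes "v \<in> vcarrier V" "w \<in> vcarrier V"
  shows "vdiff V (vsmult V c v) (vsmult V c w) = vsmult V c (vdiff V v w)"
  using assms by (simp add: vdiff_def smult_add smult_closed smult_smult)

lemma diff_add_cancel:
  assumes "v \<in> vcarrier V" "w \<in> vcarrier V"
  shows "vadd V (vdiff V v w) w = v"
proof -
  have "vadd V (vsmult V (- 1) w) w = vsmult V 0 w"
    using assms diff_self by (simp add: vdiff_def add_commute smult_closed)
  then show ?thesis
    using assms zero_add[of w v] add_commute[of v "vsmult V 0 w"]
    by (simp add: vdiff_def add_assoc smult_closed)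
qed

lemma seminorm_le_diff:
  assumes "v \<in> vcarrier V" "w \<in> vcarrier V"
  shows "\<bar>seminorm V v - seminorm V w\<bar> \<le> seminorm V (vdiff V v w)"
  using triangle[of "vdiff V v w" w] triangle[of "vdiff V w v" v] assms
  by (simp add: diff_add_cancel diff_closed seminorm_diff_commute)

subsection \<open>The quotient by the kernel of the seminorm\<close>

lemma null_class_self: "v \<in> vcarrier V \<Longrightarrow> v \<in> null_class V v"
  by (simp add: null_class_def seminorm_diff_self)

lemma null_class_carrier: "w \<in> null_class V v \<Longrightarrow> w \<in> vcarrier V"
  by (simp add: null_class_def)

lemma seminorm_null_class:
  assumes "v \<in> vcarrier V" "w \<in> null_class V v"
  shows "seminorm V w = seminorm V v"
  using seminorm_le_diff[of v w] assms by (simp add: null_class_def)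

lemma null_class_eqI:
  assumes "v \<in> vcarrier V" "w \<in> null_class V v"
  shows "null_class V w = null_class V v"
proof -
  have "seminorm V (vdiff V w x) = 0 \<longleftrightarrow> seminorm V (vdiff V v x) = 0" if "x \<in> vcarrier V" for x
    using assms that seminorm_diff_triangle[of w v x] seminorm_diff_triangle[of v w x]
      seminorm_nonneg[OF diff_closed[of v x]] seminorm_nonneg[OF diff_closed[of w x]]
      seminorm_diff_commute[of v w]
    by (auto simp: null_class_def)
  then show ?thesis
    by (auto simp: null_class_def)
qed

lemma quotient_carrier: "vcarrier (null_quotient V) = null_class V ` vcarrier V"
  by (simp add: null_quotient_def)

text \<open>Addition of classes is a union over all pairs of representatives. A difference of two
  such sums has seminorm at most 0 + 0, so all sets in the union are one and the same class.\<close>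

lemma quotient_add:
  assumes "v \<in> vcarrier V" "w \<in> vcarrier V"
  shows "vadd (null_quotient V) (null_class V v) (null_class V w) = null_class V (vadd V v w)"
proof -
  have "null_class V (vadd V v' w') = null_class V (vadd V v w)"
    if "v' \<in> null_class V v" "w' \<in> null_class V w" for v' w'
  proof (rule null_class_eqI[OF add_closed[OF assms]])
    have c: "v' \<in> vcarrier V" "w' \<in> vcarrier V"
      and z: "seminorm V (vdiff V v v') = 0" "seminorm V (vdiff V w w') = 0"
      using that by (simp_all add: null_class_def)
    have "seminorm V (vdiff V (vadd V v w) (vadd V v' w')) \<le> 0"
      using triangle[OF diff_closed[OF assms(1) c(1)] diff_closed[OF assms(2) c(2)]] z
      by (simp add: diff_of_sums assms c)
    then show "vadd V v' w' \<in> null_class V (vadd V v w)"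
      using seminorm_nonneg[OF diff_closed[OF add_closed[OF assms] add_closed[OF c]]] add_closed[OF c]
      by (simp add: null_class_def)
  qed
  then have "vadd (null_quotient V) (null_class V v) (null_class V w)
      = (\<Union>v'\<in>null_class V v. \<Union>w'\<in>null_class V w. null_class V (vadd V v w))"
    unfolding null_quotient_def by simp
  then show ?thesis
    using null_class_self[OF assms(1)] null_class_self[OF assms(2)] by (auto simp del: UN_simps)
qed

lemma quotient_smult:
  assumes "v \<in> vcarrier V"
  shows "vsmult (null_quotient V) c (null_class V v) = null_class V (vsmult V c v)"
proof -
  have "null_class V (vsmult V c v') = null_class V (vsmult V c v)" if "v' \<in> null_class V v" for v'
  proof (rule null_class_eqI[OF smult_closed[OF assms]])
    have "v' \<in> vcarrier V" "seminorm V (vdiff V v v') = 0"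
      using that by (simp_all add: null_class_def)
    then show "vsmult V c v' \<in> null_class V (vsmult V c v)"
      using diff_closed[OF assms, of v']
      by (simp add: null_class_def diff_of_multiples assms homogeneous smult_closed)
  qed
  then have "vsmult (null_quotient V) c (null_class V v)
      = (\<Union>v'\<in>null_class V v. null_class V (vsmult V c v))"
    unfolding null_quotient_def by simp
  then show ?thesis
    using null_class_self[OF assms] by (auto simp del: UN_simps)
qed

lemma some_null_class: "v \<in> vcarrier V \<Longrightarrow> (SOME w. w \<in> null_class V v) \<in> null_class V v"
  using null_class_self[of v] by (rule someI)

lemma quotient_seminorm:
  assumes "v \<in> vcarrier V"
  shows "seminorm (null_quotient V) (null_class V v) = seminorm V v"
  using seminorm_null_class[OF assms some_null_class[OF assms]] by (simp add: null_quotient_def)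

lemma seminormed_vector_space_null_quotient: "seminormed_vector_space (null_quotient V)"
proof (unfold_locales, unfold quotient_carrier)
  fix A B assume "A \<in> null_class V ` vcarrier V" "B \<in> null_class V ` vcarrier V"
  then show "vadd (null_quotient V) A B = vadd (null_quotient V) B A"
    by (elim imageE) (simp add: quotient_add, simp add: add_commute)
qed (auto simp: quotient_add quotient_smult quotient_seminorm add_closed smult_closed
      add_assoc smult_add add_smult smult_smult smult_one zero_add triangle homogeneous)

end

text \<open>In \<open>bounded_linear_functional\<close> the constant hides behind an existential
  quantifier. With C as a parameter, the same C passes unchanged from the algebraic tensor product
  to Cauchy sequences and on to their quotient.\<close>

definition functional_bound ::
  "('k::real_normed_field, 'v) seminormed_space \<Rightarrow> ('v \<Rightarrow> 'k) \<Rightarrow> real \<Rightarrow> bool" where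
  "functional_bound V T C \<longleftrightarrow>
     (\<forall>v\<in>vcarrier V. \<forall>w\<in>vcarrier V. T (vadd V v w) = T v + T w) \<and>
     (\<forall>c. \<forall>v\<in>vcarrier V. T (vsmult V c v) = c * T v) \<and>
     (\<forall>v\<in>vcarrier V. norm (T v) \<le> C * seminorm V v)"

lemma functional_bound_imp_bounded_linear:
  "functional_bound V T C \<Longrightarrow> bounded_linear_functional V T"
  by (auto simp: functional_bound_def bounded_linear_map_def scalars_def)

text \<open>The vector v keeps the set under the supremum nonempty; \<open>Sup\<close> of the empty
  set of reals says nothing.\<close>

lemma functional_bound_op_norm_le:
  assumes "functional_bound V T C" "0 \<le> C" "v \<in> vcarrier V" "seminorm V v \<le> 1"
  shows "op_norm V scalars T \<le> C"
  unfolding op_norm_def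
proof (rule cSup_least)
  fix x assume "x \<in> {seminorm scalars (T v) |v. v \<in> vcarrier V \<and> seminorm V v \<le> 1}"
  then obtain v where v: "x = norm (T v)" "v \<in> vcarrier V" "seminorm V v \<le> 1"
    by (auto simp: scalars_def)
  then have "x \<le> C * seminorm V v"
    using assms(1) by (simp add: functional_bound_def)
  also have "\<dots> \<le> C * 1"
    using assms(2) v by (intro mult_left_mono) auto
  finally show "x \<le> C" by simp
qed (use assms in auto)

context seminormed_vector_space
begin

lemma functional_bound_diff:
  assumes "functional_bound V T C" "v \<in> vcarrier V" "w \<in> vcarrier V"
  shows "T (vdiff V v w) = T v - T w"
  using assms by (simp add: functional_bound_def vdiff_def smult_closed)

lemma functional_bound_null_class:
  assumes "functional_bound V T C" "v \<in> vcarrier V" "w \<in> null_class V v"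
  shows "T w = T v"
proof -
  have "vdiff V v w \<in> vcarrier V"
    using assms by (simp add: null_class_def diff_closed)
  with assms(1) have "norm (T (vdiff V v w)) \<le> C * seminorm V (vdiff V v w)"
    by (simp add: functional_bound_def)
  moreover have "seminorm V (vdiff V v w) = 0" "w \<in> vcarrier V"
    using assms(3) by (simp_all add: null_class_def)
  ultimately show ?thesis
    using functional_bound_diff[OF assms(1), of v w] assms(2) by simp
qed

text \<open>The functional U on classes is left arbitrary so that it can be one defined by a choice
  of representative (\<open>L1_integral\<close>) or by a description
  (\<open>extend_by_continuity\<close>).\<close>

lemma functional_bound_null_quotient:
  assumes "functional_bound V T C" "\<And>v. v \<in> vcarrier V \<Longrightarrow> U (null_class V v) = T v"
  shows "functional_bound (null_quotient V) U C"
  using assms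
  by (auto simp: functional_bound_def quotient_carrier quotient_add quotient_smult quotient_seminorm
      add_closed smult_closed)

lemma functional_bound_cong:
  assumes "functional_bound V T C" "\<And>v. v \<in> vcarrier V \<Longrightarrow> U v = T v"
  shows "functional_bound V U C"
  using assms by (auto simp: functional_bound_def add_closed smult_closed)

subsection \<open>Cauchy sequences and the completion\<close>

text \<open>The seminorm of a Cauchy sequence is a \<open>lim\<close>; the reverse triangle
  inequality makes the seminorms a Cauchy sequence of reals, so this limit exists.\<close>

lemma cauchy_seminorm_tendsto:
  assumes "s \<in> vcarrier (cauchy_sequences V)"
  shows "(\<lambda>n. seminorm V (s n)) \<longlonglongrightarrow> seminorm (cauchy_sequences V) s"
proof -
  have "Cauchy (\<lambda>n. seminorm V (s n))"
  proof (rule metric_CauchyI)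
    fix e :: real assume "0 < e"
    then obtain N where N: "\<forall>m\<ge>N. \<forall>n\<ge>N. seminorm V (vdiff V (s m) (s n)) < e"
      using assms by (auto simp: cauchy_sequences_def)
    have "dist (seminorm V (s m)) (seminorm V (s n)) < e" if "m \<ge> N" "n \<ge> N" for m n
    proof -
      have "s m \<in> vcarrier V" "s n \<in> vcarrier V"
        using assms by (auto simp: cauchy_sequences_def)
      from seminorm_le_diff[OF this] N that show ?thesis
        by (metis dist_real_def order.strict_trans1)
    qed
    then show "\<exists>N. \<forall>m\<ge>N. \<forall>n\<ge>N. dist (seminorm V (s m)) (seminorm V (s n)) < e"
      by blast
  qed
  then show ?thesis
    by (simp add: Cauchy_convergent_iff convergent_LIMSEQ_iff cauchy_sequences_def)
qed

lemma cauchy_sequencesI: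
  assumes "\<And>n. s n \<in> vcarrier V"
    and "\<And>e. 0 < e \<Longrightarrow> \<exists>N. \<forall>m\<ge>N. \<forall>n\<ge>N. seminorm V (vdiff V (s m) (s n)) < e"
  shows "s \<in> vcarrier (cauchy_sequences V)"
  using assms by (simp add: cauchy_sequences_def)

lemma cauchy_sequencesE:
  assumes "s \<in> vcarrier (cauchy_sequences V)" "0 < e"
  obtains N where "\<And>m n. m \<ge> N \<Longrightarrow> n \<ge> N \<Longrightarrow> seminorm V (vdiff V (s m) (s n)) < e"
  using assms unfolding cauchy_sequences_def by simp blast

lemma cauchy_sequences_carrier: "s \<in> vcarrier (cauchy_sequences V) \<Longrightarrow> s n \<in> vcarrier V"
  by (simp add: cauchy_sequences_def)

lemma cauchy_sequences_add:
  assumes "s \<in> vcarrier (cauchy_sequences V)" "t \<in> vcarrier (cauchy_sequences V)"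
  shows "(\<lambda>n. vadd V (s n) (t n)) \<in> vcarrier (cauchy_sequences V)"
proof (rule cauchy_sequencesI)
  have c: "s n \<in> vcarrier V" "t n \<in> vcarrier V" for n
    using assms by (auto intro: cauchy_sequences_carrier)
  then show "vadd V (s n) (t n) \<in> vcarrier V" for n
    by (simp add: add_closed)
  fix e :: real assume "0 < e"
  then have "0 < e / 2" by simp
  obtain N where N: "\<And>m n. m \<ge> N \<Longrightarrow> n \<ge> N \<Longrightarrow> seminorm V (vdiff V (s m) (s n)) < e / 2"
    using cauchy_sequencesE[OF assms(1) \<open>0 < e / 2\<close>] by blast
  obtain M where M: "\<And>m n. m \<ge> M \<Longrightarrow> n \<ge> M \<Longrightarrow> seminorm V (vdiff V (t m) (t n)) < e / 2"
    using cauchy_sequencesE[OF assms(2) \<open>0 < e / 2\<close>] by blast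
  have "seminorm V (vdiff V (vadd V (s m) (t m)) (vadd V (s n) (t n))) < e"
    if "m \<ge> max M N" "n \<ge> max M N" for m n
    using triangle[OF diff_closed[OF c(1)[of m] c(1)[of n]] diff_closed[OF c(2)[of m] c(2)[of n]]]
      N[of m n] M[of m n] that by (simp add: diff_of_sums c)
  then show "\<exists>N. \<forall>m\<ge>N. \<forall>n\<ge>N. seminorm V (vdiff V (vadd V (s m) (t m)) (vadd V (s n) (t n))) < e"
    by blast
qed

lemma cauchy_sequences_smult:
  assumes "s \<in> vcarrier (cauchy_sequences V)"
  shows "(\<lambda>n. vsmult V c (s n)) \<in> vcarrier (cauchy_sequences V)"
proof (rule cauchy_sequencesI)
  have c: "s n \<in> vcarrier V" for n
    using assms by (auto intro: cauchy_sequences_carrier)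
  then show "vsmult V c (s n) \<in> vcarrier V" for n
    by (simp add: smult_closed)
  fix e :: real assume "0 < e"
  \<comment> \<open>The added 1 takes care of c = 0.\<close>
  then have "0 < e / (norm c + 1)"
    by (simp add: add_nonneg_pos)
  then obtain N where
    N: "\<And>m n. m \<ge> N \<Longrightarrow> n \<ge> N \<Longrightarrow> seminorm V (vdiff V (s m) (s n)) < e / (norm c + 1)"
    using cauchy_sequencesE[OF assms] by blast
  have "seminorm V (vdiff V (vsmult V c (s m)) (vsmult V c (s n))) < e" if "m \<ge> N" "n \<ge> N" for m n
  proof -
    have "norm c * seminorm V (vdiff V (s m) (s n)) \<le> (norm c + 1) * seminorm V (vdiff V (s m) (s n))"
      by (intro mult_right_mono seminorm_nonneg diff_closed c) simp
    also have "\<dots> < e"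
      using N[OF that] by (simp add: add_nonneg_pos pos_less_divide_eq mult.commute)
    finally show ?thesis
      by (simp add: diff_of_multiples c homogeneous diff_closed)
  qed
  then show "\<exists>N. \<forall>m\<ge>N. \<forall>n\<ge>N. seminorm V (vdiff V (vsmult V c (s m)) (vsmult V c (s n))) < e"
    by blast
qed

lemma cauchy_sequences_simps:
  "vadd (cauchy_sequences V) s t = (\<lambda>n. vadd V (s n) (t n))"
  "vsmult (cauchy_sequences V) c s = (\<lambda>n. vsmult V c (s n))"
  by (simp_all add: cauchy_sequences_def)

lemma seminormed_vector_space_cauchy_sequences: "seminormed_vector_space (cauchy_sequences V)"
proof
  fix s t assume st: "s \<in> vcarrier (cauchy_sequences V)" "t \<in> vcarrier (cauchy_sequences V)"
  show "seminorm (cauchy_sequences V) (vadd (cauchy_sequences V) s t)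
      \<le> seminorm (cauchy_sequences V) s + seminorm (cauchy_sequences V) t"
    by (rule LIMSEQ_le[OF cauchy_seminorm_tendsto
          tendsto_add[OF cauchy_seminorm_tendsto cauchy_seminorm_tendsto]])
      (use st in \<open>auto simp: cauchy_sequences_simps cauchy_sequences_add cauchy_sequences_carrier
        intro!: exI[of _ 0] triangle\<close>)
  show "vadd (cauchy_sequences V) s t = vadd (cauchy_sequences V) t s"
    using add_commute[OF cauchy_sequences_carrier[OF st(1)] cauchy_sequences_carrier[OF st(2)]]
    by (simp add: cauchy_sequences_simps)
next
  fix s c assume s: "s \<in> vcarrier (cauchy_sequences V)"
  have "(\<lambda>n. seminorm V (vsmult V c (s n))) \<longlonglongrightarrow> seminorm (cauchy_sequences V) (vsmult (cauchy_sequences V) c s)"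
    using cauchy_seminorm_tendsto[OF cauchy_sequences_smult[OF s, of c]]
    by (simp add: cauchy_sequences_simps)
  moreover have "(\<lambda>n. seminorm V (vsmult V c (s n))) \<longlonglongrightarrow> norm c * seminorm (cauchy_sequences V) s"
    using tendsto_mult_left[OF cauchy_seminorm_tendsto[OF s], of "norm c"] s
    by (simp add: homogeneous cauchy_sequences_carrier)
  ultimately show "seminorm (cauchy_sequences V) (vsmult (cauchy_sequences V) c s)
      = norm c * seminorm (cauchy_sequences V) s"
    by (rule LIMSEQ_unique)
qed (auto simp: cauchy_sequences_simps cauchy_sequences_add cauchy_sequences_smult
      cauchy_sequences_carrier add_assoc smult_add add_smult smult_smult smult_one zero_add)

end

section \<open>Extension of a bounded functional to the completion\<close>

locale functional_on_seminormed_space = seminormed_vector_space V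
  for V :: "('k::{real_normed_field, banach}, 'v) seminormed_space" +
  fixes F :: "'v \<Rightarrow> 'k" and C :: real
  assumes bound: "functional_bound V F C" and C_nonneg: "0 \<le> C"
begin

lemma functional_cauchy_convergent:
  assumes "s \<in> vcarrier (cauchy_sequences V)"
  shows "(\<lambda>n. F (s n)) \<longlonglongrightarrow> lim (\<lambda>n. F (s n))"
proof -
  have c: "s n \<in> vcarrier V" for n
    using assms by (rule cauchy_sequences_carrier)
  have "Cauchy (\<lambda>n. F (s n))"
  proof (rule metric_CauchyI)
    fix e :: real assume "0 < e"
    then have "0 < e / (C + 1)" using C_nonneg by simp
    then obtain N where
      N: "\<And>m n. m \<ge> N \<Longrightarrow> n \<ge> N \<Longrightarrow> seminorm V (vdiff V (s m) (s n)) < e / (C + 1)"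
      using cauchy_sequencesE[OF assms] by blast
    have "dist (F (s m)) (F (s n)) < e" if "m \<ge> N" "n \<ge> N" for m n
    proof -
      have "dist (F (s m)) (F (s n)) = norm (F (vdiff V (s m) (s n)))"
        by (simp add: dist_norm functional_bound_diff[OF bound c c])
      also have "\<dots> \<le> C * seminorm V (vdiff V (s m) (s n))"
        using bound c by (simp add: functional_bound_def diff_closed)
      also have "\<dots> \<le> (C + 1) * seminorm V (vdiff V (s m) (s n))"
        by (intro mult_right_mono seminorm_nonneg diff_closed c) simp
      also have "\<dots> < e"
        using N[OF that] C_nonneg by (simp add: pos_less_divide_eq mult.commute)
      finally show ?thesis .
    qed
    then show "\<exists>N. \<forall>m\<ge>N. \<forall>n\<ge>N. dist (F (s m)) (F (s n)) < e"
      by blast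
  qed
  then show ?thesis
    by (simp add: Cauchy_convergent_iff convergent_LIMSEQ_iff)
qed

lemma functional_bound_cauchy_sequences:
  "functional_bound (cauchy_sequences V) (\<lambda>s. lim (\<lambda>n. F (s n))) C"
  unfolding functional_bound_def
proof (intro conjI ballI allI)
  fix s t assume "s \<in> vcarrier (cauchy_sequences V)" "t \<in> vcarrier (cauchy_sequences V)"
  then have "(\<lambda>n. F (vadd V (s n) (t n))) \<longlonglongrightarrow> lim (\<lambda>n. F (s n)) + lim (\<lambda>n. F (t n))"
    using tendsto_add[OF functional_cauchy_convergent[of s] functional_cauchy_convergent[of t]] bound
    by (simp add: functional_bound_def cauchy_sequences_carrier)
  then show "lim (\<lambda>n. F (vadd (cauchy_sequences V) s t n)) = lim (\<lambda>n. F (s n)) + lim (\<lambda>n. F (t n))"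
    by (simp add: cauchy_sequences_simps limI)
next
  fix s c assume "s \<in> vcarrier (cauchy_sequences V)"
  then have "(\<lambda>n. F (vsmult V c (s n))) \<longlonglongrightarrow> c * lim (\<lambda>n. F (s n))"
    using tendsto_mult_left[OF functional_cauchy_convergent[of s], of c] bound
    by (simp add: functional_bound_def cauchy_sequences_carrier)
  then show "lim (\<lambda>n. F (vsmult (cauchy_sequences V) c s n)) = c * lim (\<lambda>n. F (s n))"
    by (simp add: cauchy_sequences_simps limI)
next
  fix s assume s: "s \<in> vcarrier (cauchy_sequences V)"
  show "norm (lim (\<lambda>n. F (s n))) \<le> C * seminorm (cauchy_sequences V) s"
    by (rule LIMSEQ_le[OF tendsto_norm[OF functional_cauchy_convergent[OF s]]
          tendsto_mult_left[OF cauchy_seminorm_tendsto[OF s]]])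
      (use s bound in \<open>auto simp: functional_bound_def cauchy_sequences_carrier\<close>)
qed

text \<open>The functional taking s to the limit of F (s n) is bounded by the seminorm of Cauchy
  sequences, hence constant on null classes. That all representatives share this limit is what the
  description in \<open>extend_by_continuity\<close> needs; uniqueness follows because s lies in its
  own class.\<close>

lemma extend_by_continuity_null_class:
  assumes "s \<in> vcarrier (cauchy_sequences V)"
  shows "extend_by_continuity F (null_class (cauchy_sequences V) s) = lim (\<lambda>n. F (s n))"
proof -
  interpret cs: seminormed_vector_space "cauchy_sequences V"
    by (rule seminormed_vector_space_cauchy_sequences)
  have "(\<lambda>n. F (t n)) \<longlonglongrightarrow> lim (\<lambda>n. F (s n))" if "t \<in> null_class (cauchy_sequences V) s" for t
    using functional_cauchy_convergent[OF cs.null_class_carrier[OF that]]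
      cs.functional_bound_null_class[OF functional_bound_cauchy_sequences assms that] by simp
  then show ?thesis
    unfolding extend_by_continuity_def
    by (intro the_equality)
      (auto intro: LIMSEQ_unique cs.null_class_self[OF assms] functional_cauchy_convergent[OF assms])
qed

lemma functional_bound_completion: "functional_bound (sn_completion V) (extend_by_continuity F) C"
proof -
  interpret cs: seminormed_vector_space "cauchy_sequences V"
    by (rule seminormed_vector_space_cauchy_sequences)
  show ?thesis
    unfolding sn_completion_def
    by (rule cs.functional_bound_null_quotient[OF functional_bound_cauchy_sequences
          extend_by_continuity_null_class])
qed

lemma constant_cauchy_sequence:
  "v \<in> vcarrier V \<Longrightarrow> (\<lambda>_. v) \<in> vcarrier (cauchy_sequences V)"
  by (auto intro!: cauchy_sequencesI simp: seminorm_diff_self)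

lemma extend_by_continuity_to_completion:
  "v \<in> vcarrier V \<Longrightarrow> extend_by_continuity F (to_completion V v) = F v"
  by (simp add: to_completion_def extend_by_continuity_null_class constant_cauchy_sequence)

lemma op_norm_completion_le:
  assumes "v \<in> vcarrier V"
  shows "op_norm (sn_completion V) scalars (extend_by_continuity F) \<le> C"
proof -
  interpret cs: seminormed_vector_space "cauchy_sequences V"
    by (rule seminormed_vector_space_cauchy_sequences)
  \<comment> \<open>The zero vector is 0 times any vector; its class is the element of the unit ball
    that keeps the supremum meaningful.\<close>
  let ?z = "vsmult (cauchy_sequences V) 0 (\<lambda>_. v)"
  have z: "?z \<in> vcarrier (cauchy_sequences V)"
    by (rule cs.smult_closed[OF constant_cauchy_sequence[OF assms]])
  have "seminorm (cauchy_sequences V) ?z = 0"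
    by (simp add: cs.homogeneous[OF constant_cauchy_sequence[OF assms]])
  then show ?thesis
    using functional_bound_op_norm_le[OF functional_bound_completion C_nonneg,
        of "null_class (cauchy_sequences V) ?z"] cs.quotient_seminorm[OF z] z
    by (simp add: sn_completion_def cs.quotient_carrier)
qed

end


section \<open>The projective tensor product\<close>

text \<open>Sums of tensors are concatenations of lists and scalars go into the first factor, so the
  linear structure is asked of X. The seminorm of Y enters through the costs, which must be bounded
  below for the infimum to make sense.\<close>

locale seminormed_pair =
  X: seminormed_vector_space X for X :: "('k::real_normed_field, 'x) seminormed_space" +
  fixes Y :: "('k, 'y) seminormed_space"
  assumes Y_nonneg: "y \<in> vcarrier Y \<Longrightarrow> 0 \<le> seminorm Y y"
begin

definition cost :: "('x \<times> 'y) list \<Rightarrow> real" where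
  "cost ps = (\<Sum>(x, y)\<leftarrow>ps. seminorm X x * seminorm Y y)"

lemma cost_nonneg: "set ps \<subseteq> vcarrier X \<times> vcarrier Y \<Longrightarrow> 0 \<le> cost ps"
  unfolding cost_def by (induction ps) (auto simp: X.seminorm_nonneg Y_nonneg)

lemma seminorm_alg_tensor: "seminorm (alg_tensor X Y) u = Inf {cost ps | ps. represents X Y ps u}"
  by (simp add: alg_tensor_def cost_def)

lemma carrier_alg_tensor: "u \<in> vcarrier (alg_tensor X Y) \<longleftrightarrow> (\<exists>ps. represents X Y ps u)"
  by (simp add: alg_tensor_def)

lemma alg_tensor_simps:
  "vadd (alg_tensor X Y) u v = (\<lambda>b. u b + v b)"
  "vsmult (alg_tensor X Y) c u = (\<lambda>b. c * u b)"
  by (simp_all add: alg_tensor_def)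

lemma tensor_norm_le:
  assumes "represents X Y ps u"
  shows "seminorm (alg_tensor X Y) u \<le> cost ps"
  unfolding seminorm_alg_tensor
  by (rule cInf_lower)
    (use assms in \<open>auto intro!: bdd_belowI[of _ 0] cost_nonneg simp: represents_def\<close>)

text \<open>This is how every bound by the projective norm is obtained: compare with each
  representation, then pass to the infimum. The factor K is divided out, so K = 0 is separate; there
  a single representation gives the claim.\<close>

lemma tensor_norm_greatest:
  assumes "u \<in> vcarrier (alg_tensor X Y)" "0 \<le> K"
    and le: "\<And>ps. represents X Y ps u \<Longrightarrow> x \<le> K * cost ps"
  shows "x \<le> K * seminorm (alg_tensor X Y) u"
proof (cases "K = 0")
  case True
  then show ?thesis
    using assms by (auto simp: carrier_alg_tensor)
next
  case False
  with \<open>0 \<le> K\<close> have K: "0 < K" by simp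
  have "x / K \<le> seminorm (alg_tensor X Y) u"
    unfolding seminorm_alg_tensor
    by (rule cInf_greatest)
      (use assms K in \<open>auto simp: carrier_alg_tensor pos_divide_le_eq mult.commute\<close>)
  then show ?thesis
    using K by (simp add: pos_divide_le_eq mult.commute)
qed

lemma represents_append:
  "represents X Y ps u \<Longrightarrow> represents X Y qs v \<Longrightarrow> represents X Y (ps @ qs) (\<lambda>b. u b + v b)"
  by (auto simp: represents_def)

lemma represents_scale:
  assumes "represents X Y ps u"
  shows "represents X Y (map (\<lambda>(x, y). (vsmult X c x, y)) ps) (\<lambda>b. c * u b)"
proof -
  have "elem_tensor X Y (vsmult X c x) y b = c * elem_tensor X Y x y b"
    if "x \<in> vcarrier X" "y \<in> vcarrier Y" for x y b
    using that by (simp add: elem_tensor_def bilinear_form_def)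
  then have "set ps \<subseteq> vcarrier X \<times> vcarrier Y \<Longrightarrow>
      (\<Sum>(x, y)\<leftarrow>map (\<lambda>(x, y). (vsmult X c x, y)) ps. elem_tensor X Y x y b)
      = c * (\<Sum>(x, y)\<leftarrow>ps. elem_tensor X Y x y b)" for b
    by (induction ps) (auto simp: distrib_left)
  then show ?thesis
    using assms by (auto simp: represents_def X.smult_closed)
qed

lemma cost_scale:
  "set ps \<subseteq> vcarrier X \<times> vcarrier Y \<Longrightarrow>
    cost (map (\<lambda>(x, y). (vsmult X c x, y)) ps) = norm c * cost ps"
  unfolding cost_def by (induction ps) (auto simp: X.homogeneous distrib_left)

lemma alg_tensor_smult_closed:
  "u \<in> vcarrier (alg_tensor X Y) \<Longrightarrow> (\<lambda>b. c * u b) \<in> vcarrier (alg_tensor X Y)"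
  by (auto simp: carrier_alg_tensor intro: represents_scale)

lemma alg_tensor_seminorm_smult_le:
  assumes "u \<in> vcarrier (alg_tensor X Y)"
  shows "seminorm (alg_tensor X Y) (\<lambda>b. c * u b) \<le> norm c * seminorm (alg_tensor X Y) u"
proof (rule tensor_norm_greatest[OF assms])
  fix ps assume "represents X Y ps u"
  with tensor_norm_le[OF represents_scale[OF this, of c]] cost_scale[of ps c]
  show "seminorm (alg_tensor X Y) (\<lambda>b. c * u b) \<le> norm c * cost ps"
    by (simp add: represents_def)
qed simp

lemma seminormed_vector_space_alg_tensor: "seminormed_vector_space (alg_tensor X Y)"
proof (rule seminormed_vector_space.intro)
  fix u v assume uv: "u \<in> vcarrier (alg_tensor X Y)" "v \<in> vcarrier (alg_tensor X Y)"
  show "vadd (alg_tensor X Y) u v \<in> vcarrier (alg_tensor X Y)"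
  proof -
    obtain ps qs where "represents X Y ps u" "represents X Y qs v"
      using uv by (auto simp: carrier_alg_tensor)
    from represents_append[OF this] show ?thesis
      unfolding carrier_alg_tensor alg_tensor_simps by (rule exI)
  qed
  \<comment> \<open>With one norm moved to the left, the two infima can be taken one after the
    other: for each fixed representation of v, first over those of u.\<close>
  have "seminorm (alg_tensor X Y) (\<lambda>b. u b + v b) - seminorm (alg_tensor X Y) u
      \<le> 1 * seminorm (alg_tensor X Y) v"
  proof (rule tensor_norm_greatest[OF uv(2)])
    fix qs assume qs: "represents X Y qs v"
    have "seminorm (alg_tensor X Y) (\<lambda>b. u b + v b) - cost qs \<le> 1 * seminorm (alg_tensor X Y) u"
    proof (rule tensor_norm_greatest[OF uv(1)])
      fix ps assume "represents X Y ps u"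
      from tensor_norm_le[OF represents_append[OF this qs]]
      show "seminorm (alg_tensor X Y) (\<lambda>b. u b + v b) - cost qs \<le> 1 * cost ps"
        by (simp add: cost_def)
    qed simp
    then show "seminorm (alg_tensor X Y) (\<lambda>b. u b + v b) - seminorm (alg_tensor X Y) u \<le> 1 * cost qs"
      by simp
  qed simp
  then show "seminorm (alg_tensor X Y) (vadd (alg_tensor X Y) u v)
      \<le> seminorm (alg_tensor X Y) u + seminorm (alg_tensor X Y) v"
    by (simp add: alg_tensor_simps)
next
  fix u :: "('x \<Rightarrow> 'y \<Rightarrow> 'k) \<Rightarrow> 'k" and c :: 'k
  assume u: "u \<in> vcarrier (alg_tensor X Y)"
  have "norm c * seminorm (alg_tensor X Y) u \<le> seminorm (alg_tensor X Y) (\<lambda>b. c * u b)"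
  proof (cases "c = 0")
    case True
    have "0 \<le> 1 * seminorm (alg_tensor X Y) (\<lambda>b. c * u b)"
      by (rule tensor_norm_greatest[OF alg_tensor_smult_closed[OF u]])
        (auto simp: represents_def cost_nonneg)
    then show ?thesis
      using True by simp
  next
    case False
    \<comment> \<open>The reverse inequality is the one already known, applied to c * u and the
      scalar inverse c.\<close>
    have "seminorm (alg_tensor X Y) (\<lambda>b. inverse c * (c * u b))
        \<le> norm (inverse c) * seminorm (alg_tensor X Y) (\<lambda>b. c * u b)"
      by (rule alg_tensor_seminorm_smult_le[OF alg_tensor_smult_closed[OF u]])
    moreover have "inverse c * (c * x) = x" for x
      using False by (simp add: mult.assoc[symmetric])
    ultimately show ?thesis
      using False by (simp add: norm_divide field_simps)
  qed
  then show "seminorm (alg_tensor X Y) (vsmult (alg_tensor X Y) c u) = norm c * seminorm (alg_tensor X Y) u"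
    using alg_tensor_seminorm_smult_le[OF u, of c] by (simp add: alg_tensor_simps)
qed (simp_all add: alg_tensor_simps alg_tensor_smult_closed algebra_simps)

lemma represents_elem_tensor:
  "x \<in> vcarrier X \<Longrightarrow> y \<in> vcarrier Y \<Longrightarrow> represents X Y [(x, y)] (elem_tensor X Y x y)"
  by (simp add: represents_def)

lemma represents_eval:
  "bilinear_form X Y f \<Longrightarrow> represents X Y ps u \<Longrightarrow> (\<Sum>(x, y)\<leftarrow>ps. f x y) = u f"
  by (simp add: represents_def elem_tensor_def)

text \<open>Since tensors are functionals on bilinear forms, extending a bilinear form linearly means
  evaluating at it.\<close>

lemma extend_linearly_eq:
  assumes "bilinear_form X Y f" "u \<in> vcarrier (alg_tensor X Y)"
  shows "extend_linearly X Y f u = u f"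
  unfolding extend_linearly_def
  using assms represents_eval[OF assms(1)] by (intro the_equality) (auto simp: carrier_alg_tensor)

text \<open>On the carrier the linear extension is evaluation at f, for which linearity is
  immediate. The bound on elementary tensors adds up along any representation and then survives the
  infimum.\<close>

lemma functional_bound_alg_tensor:
  assumes f: "bilinear_form X Y f" and "0 \<le> C"
    and bd: "\<And>x y. x \<in> vcarrier X \<Longrightarrow> y \<in> vcarrier Y \<Longrightarrow>
      norm (f x y) \<le> C * (seminorm X x * seminorm Y y)"
  shows "functional_bound (alg_tensor X Y) (extend_linearly X Y f) C"
proof (rule seminormed_vector_space.functional_bound_cong[OF seminormed_vector_space_alg_tensor])
  show "functional_bound (alg_tensor X Y) (\<lambda>u. u f) C"
    unfolding functional_bound_def
  proof (intro conjI ballI allI)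
    fix u assume u: "u \<in> vcarrier (alg_tensor X Y)"
    show "norm (u f) \<le> C * seminorm (alg_tensor X Y) u"
    proof (rule tensor_norm_greatest[OF u \<open>0 \<le> C\<close>])
      fix ps assume ps: "represents X Y ps u"
      then have "set ps \<subseteq> vcarrier X \<times> vcarrier Y"
        by (simp add: represents_def)
      then have "norm (\<Sum>(x, y)\<leftarrow>ps. f x y) \<le> C * cost ps"
      proof (induction ps)
        case (Cons p ps)
        then show ?case
          using bd[of "fst p" "snd p"] norm_triangle_ineq[of "f (fst p) (snd p)" "\<Sum>(x, y)\<leftarrow>ps. f x y"]
          by (auto simp: cost_def distrib_left split: prod.splits)
      qed (simp add: cost_def)
      then show "norm (u f) \<le> C * cost ps"
        using represents_eval[OF f ps] by simp
    qed
  qed (simp_all add: alg_tensor_simps)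
qed (use extend_linearly_eq[OF f] in auto)

end

section \<open>The cotangent kernel\<close>

text \<open>Division by 0 gives 0, so this also holds at the zeros of sine and cosine.\<close>

lemma inverse_tan_eq_cot: "inverse (tan x) = cot (x::real)"
  by (simp add: tan_def cot_def)

lemma cot_plus_pi: "cot (x + pi) = cot (x::real)"
  by (simp add: cot_def)

lemma cot_minus_arg: "cot (- x) = - cot (x::real)"
  by (simp add: cot_def)

lemma tan_plus_half_pi: "tan (x + pi / 2) = - cot (x::real)" "tan (x - pi / 2) = - cot (x::real)"
  by (simp_all add: tan_def cot_def sin_add cos_add sin_diff cos_diff)

lemma cot_half_pi: "cot (pi / 2) = 0" "cot (- (pi / 2)) = 0"
  by (simp_all add: cot_def)

lemma inverse_sin_eq_cot_plus_tan:
  assumes "sin (t / 2) \<noteq> 0" "cos (t / 2) \<noteq> 0"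
  shows "inverse (sin t) = (cot (t / 2) + tan (t / 2)) / (2::real)"
proof -
  have "sin t = 2 * sin (t / 2) * cos (t / 2)"
    using sin_double[of "t / 2"] by simp
  moreover have "sin (t / 2) * sin (t / 2) + cos (t / 2) * cos (t / 2) = 1"
    using sin_cos_squared_add[of "t / 2"] by (simp add: power2_eq_square)
  ultimately show ?thesis
    using assms by (simp add: cot_def tan_def divide_simps)
qed

text \<open>For y = \<bar>x\<bar> / 2 \<le> pi / 3 the cosine is at least 1 / 2 on [0, y], so sin y
  \<ge> y / 2, and the double angle formula gives the claim. The range is chosen for x = t / 2 with
  \<bar>t\<bar> \<le> 4 * pi / 3: a point of the period moved by at most pi / 3.\<close>

lemma abs_sin_ge:
  assumes "\<bar>x\<bar> \<le> 2 * pi / 3"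
  shows "\<bar>x\<bar> / 4 \<le> \<bar>sin x\<bar>"
proof -
  define y where "y = \<bar>x\<bar> / 2"
  have y: "0 \<le> y" "y \<le> pi / 3" "\<bar>x\<bar> = 2 * y"
    using assms by (auto simp: y_def)
  have cos_ge: "1 / 2 \<le> cos z" if "0 \<le> z" "z \<le> pi / 3" for z
    using cos_monotone_0_pi_le[of z "pi / 3"] that by (simp add: cos_60)
  have "sin 0 - 0 / 2 \<le> sin y - y / 2"
  proof (rule DERIV_nonneg_imp_nondecreasing[OF y(1)])
    fix z assume "0 \<le> z" "z \<le> y"
    then show "\<exists>d. ((\<lambda>z. sin z - z / 2) has_real_derivative d) (at z) \<and> 0 \<le> d"
      using cos_ge[of z] y(2) by (intro exI[of _ "cos z - 1 / 2"]) (auto intro!: derivative_eq_intros)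
  qed
  then have sin_ge: "y / 2 \<le> sin y" by simp
  have "y / 2 * 1 \<le> sin y * (2 * cos y)"
    using sin_ge cos_ge[OF y(1,2)] y(1) by (intro mult_mono) auto
  also have "\<dots> = sin \<bar>x\<bar>"
    using y(3) by (simp add: sin_double)
  also have "\<dots> \<le> \<bar>sin x\<bar>"
    by (cases "0 \<le> x") auto
  finally show ?thesis
    using y(3) by simp
qed

lemma abs_sin_half_ge: "\<bar>t\<bar> \<le> 4 * pi / 3 \<Longrightarrow> \<bar>t\<bar> / 8 \<le> \<bar>sin (t / 2)\<bar>"
  using abs_sin_ge[of "t / 2"] by simp

lemma abs_cot_half_le:
  assumes "\<bar>t\<bar> \<le> 4 * pi / 3"
  shows "\<bar>cot (t / 2)\<bar> \<le> 8 / \<bar>t\<bar>"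
proof (cases "t = 0")
  case False
  have "\<bar>cot (t / 2)\<bar> = \<bar>cos (t / 2)\<bar> / \<bar>sin (t / 2)\<bar>"
    by (simp add: cot_def)
  also have "\<dots> \<le> 1 / (\<bar>t\<bar> / 8)"
    using False abs_sin_half_ge[OF assms] by (intro frac_le) auto
  finally show ?thesis by simp
qed (simp add: cot_def)

text \<open>The identity cot a - cot b = sin (b - a) / (sin a * sin b) replaces the mean value
  theorem, so s and t may lie on opposite sides of the pole. The constant is 8 * 8 / 2.\<close>

lemma abs_cot_diff_le:
  assumes "\<bar>s\<bar> \<le> 4 * pi / 3" "\<bar>t\<bar> \<le> 4 * pi / 3" "s \<noteq> 0" "t \<noteq> 0"
  shows "\<bar>cot (s / 2) - cot (t / 2)\<bar> \<le> 32 * \<bar>s - t\<bar> / (\<bar>s\<bar> * \<bar>t\<bar>)"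
proof -
  have ge: "\<bar>s\<bar> / 8 \<le> \<bar>sin (s / 2)\<bar>" "\<bar>t\<bar> / 8 \<le> \<bar>sin (t / 2)\<bar>"
    using abs_sin_half_ge[OF assms(1)] abs_sin_half_ge[OF assms(2)] .
  then have nz: "sin (s / 2) \<noteq> 0" "sin (t / 2) \<noteq> 0"
    using assms by auto
  then have "cot (s / 2) - cot (t / 2) = sin (t / 2 - s / 2) / (sin (s / 2) * sin (t / 2))"
    unfolding sin_diff cot_def by (simp add: field_simps)
  then have "\<bar>cot (s / 2) - cot (t / 2)\<bar> = \<bar>sin (t / 2 - s / 2)\<bar> / (\<bar>sin (s / 2)\<bar> * \<bar>sin (t / 2)\<bar>)"
    by (simp add: abs_mult)
  also have "\<dots> \<le> (\<bar>s - t\<bar> / 2) / ((\<bar>s\<bar> / 8) * (\<bar>t\<bar> / 8))"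
  proof (rule frac_le)
    show "\<bar>sin (t / 2 - s / 2)\<bar> \<le> \<bar>s - t\<bar> / 2"
      using abs_sin_x_le_abs_x[of "t / 2 - s / 2"]
      by (simp add: diff_divide_distrib[symmetric] abs_minus_commute)
    show "\<bar>s\<bar> / 8 * (\<bar>t\<bar> / 8) \<le> \<bar>sin (s / 2)\<bar> * \<bar>sin (t / 2)\<bar>"
      by (rule mult_mono[OF ge]) auto
  qed (use assms in auto)
  finally show ?thesis by simp
qed

section \<open>Integrals over the line\<close>

text \<open>Reflection of the variable preserves the Bochner integral of every function, the value
  being 0 by convention if f is not integrable; so the integral equals its own negative.\<close>

lemma integral_odd_eq_0:
  fixes f :: "real \<Rightarrow> 'a::{banach, second_countable_topology}"
  assumes "\<And>t. f (- t) = - f t"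
  shows "(\<integral>t. f t \<partial>lborel) = 0"
proof -
  have "(\<integral>t. f t \<partial>lborel) = - (\<integral>t. f t \<partial>lborel)"
    using lborel_integral_real_affine[of "-1" f 0] assms by simp
  then have "(\<integral>t. f t \<partial>lborel) + (\<integral>t. f t \<partial>lborel) = 0"
    by (metis add.right_inverse)
  then show ?thesis
    by (metis scaleR_2 scaleR_eq_0_iff zero_neq_numeral)
qed

lemma has_bochner_integral_symmetrize:
  fixes f :: "real \<Rightarrow> 'a::{banach, second_countable_topology}"
  assumes "has_bochner_integral lborel f x"
  shows "has_bochner_integral lborel (\<lambda>t. f t + f (- t)) (x + x)"
  using has_bochner_integral_add[OF assms]
    lborel_has_bochner_integral_real_affine_iff[of "-1" f x 0] assms by simp

text \<open>For nonnegative functions gauge and Lebesgue integrals agree; this carries the known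
  gauge integrals of powers over to the Bochner integral.\<close>

lemma has_bochner_integral_nonneg_real:
  fixes f :: "real \<Rightarrow> real"
  assumes "A \<in> sets borel" "f \<in> borel_measurable borel" "\<And>x. x \<in> A \<Longrightarrow> 0 \<le> f x"
    and I: "(f has_integral I) A"
  shows "has_bochner_integral lborel (\<lambda>x. indicator A x * f x) I"
proof (rule has_bochner_integral_nn_integral)
  show "(\<integral>\<^sup>+ x. ennreal (indicator A x * f x) \<partial>lborel) = ennreal I"
    by (rule nn_integral_has_integral_lebesgue[OF assms(3) I])
  show "0 \<le> I"
    by (rule has_integral_nonneg[OF I assms(3)])
qed (use assms in \<open>auto simp: indicator_def\<close>)

lemma has_bochner_integral_powr_near:
  fixes \<gamma> r :: real
  assumes "0 < \<gamma>" "0 < r"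
  shows "has_bochner_integral lborel (\<lambda>t. indicator {-r..r} t * \<bar>t\<bar> powr (\<gamma> - 1)) (2 * r powr \<gamma> / \<gamma>)"
proof -
  have "has_bochner_integral lborel (\<lambda>t. indicator {0..r} t * t powr (\<gamma> - 1)) (r powr \<gamma> / \<gamma>)"
    using has_integral_powr_from_0[of "\<gamma> - 1" r] assms
    by (intro has_bochner_integral_nonneg_real) auto
  from has_bochner_integral_symmetrize[OF this]
  have "has_bochner_integral lborel
      (\<lambda>t. indicator {0..r} t * t powr (\<gamma> - 1) + indicator {0..r} (- t) * (- t) powr (\<gamma> - 1))
      (2 * r powr \<gamma> / \<gamma>)" by simp
  \<comment> \<open>Both summands count the point t = 0, which is harmless since 0 powr a =
    0.\<close>
  moreover have "(\<lambda>t. indicator {0..r} t * t powr (\<gamma> - 1) + indicator {0..r} (- t) * (- t) powr (\<gamma> - 1))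
      = (\<lambda>t. indicator {-r..r} t * \<bar>t\<bar> powr (\<gamma> - 1))"
    using assms by (auto simp: fun_eq_iff indicator_def)
  ultimately show ?thesis by simp
qed

lemma has_bochner_integral_powr_far:
  fixes \<gamma> r :: real
  assumes "\<gamma> < 1" "0 < r"
  shows "has_bochner_integral lborel (\<lambda>t. indicator {t. r \<le> \<bar>t\<bar>} t * \<bar>t\<bar> powr (\<gamma> - 2))
    (2 * r powr (\<gamma> - 1) / (1 - \<gamma>))"
proof -
  have "- (r powr (\<gamma> - 2 + 1)) / (\<gamma> - 2 + 1) = r powr (\<gamma> - 1) / (1 - \<gamma>)"
    using assms by (simp add: divide_simps) (simp add: algebra_simps)
  then have "has_bochner_integral lborel (\<lambda>t. indicator {r..} t * t powr (\<gamma> - 2)) (r powr (\<gamma> - 1) / (1 - \<gamma>))"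
    using has_integral_powr_to_inf[of "\<gamma> - 2" r] assms
    by (intro has_bochner_integral_nonneg_real) auto
  from has_bochner_integral_symmetrize[OF this]
  have "has_bochner_integral lborel
      (\<lambda>t. indicator {r..} t * t powr (\<gamma> - 2) + indicator {r..} (- t) * (- t) powr (\<gamma> - 2))
      (2 * r powr (\<gamma> - 1) / (1 - \<gamma>))" by simp
  moreover have "(\<lambda>t. indicator {r..} t * t powr (\<gamma> - 2) + indicator {r..} (- t) * (- t) powr (\<gamma> - 2))
      = (\<lambda>t. indicator {t. r \<le> \<bar>t\<bar>} t * \<bar>t\<bar> powr (\<gamma> - 2))"
    using assms by (auto simp: fun_eq_iff indicator_def)
  ultimately show ?thesis by simp
qed

text \<open>The period is cut at - pi + h and the left piece is moved by 2 * pi to the right end.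
  What results is an integral over (- pi + h, pi + h], which translates back to the original
  period.\<close>

lemma has_bochner_integral_periodic_shift:
  fixes f :: "real \<Rightarrow> 'a::{banach, second_countable_topology}"
  assumes per: "\<And>t. f (t + 2 * pi) = f t"
    and int: "set_integrable lborel {-pi<..pi} f" and h: "0 \<le> h" "h \<le> 2 * pi"
  shows "has_bochner_integral lborel (\<lambda>t. indicator {-pi<..pi} t *\<^sub>R f (t + h)) (LBINT t:{-pi<..pi}. f t)"
proof -
  let ?F = "\<lambda>A t. indicator A t *\<^sub>R f t"
  have hbi: "has_bochner_integral lborel (?F A) (LBINT t:A. f t)"
    if "A \<subseteq> {-pi<..pi}" "A \<in> sets lborel" for A
    using set_integrable_subset[OF int that(2,1)]
    by (simp add: has_bochner_integral_iff set_integrable_def set_lebesgue_integral_def)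
  have split: "(LBINT t:{-pi<..pi}. f t) = (LBINT t:{-pi<..-pi+h}. f t) + (LBINT t:{-pi+h<..pi}. f t)"
  proof -
    have eq: "{-pi<..pi} = {-pi<..-pi+h} \<union> {-pi+h<..pi}"
      using h by auto
    show ?thesis
      unfolding eq
    proof (rule set_integral_Un)
      show "set_integrable lborel {-pi<..-pi+h} f" "set_integrable lborel {-pi+h<..pi} f"
        by (rule set_integrable_subset[OF int]; use h in force)+
    qed auto
  qed
  have "has_bochner_integral lborel (?F {-pi<..-pi+h}) (LBINT t:{-pi<..-pi+h}. f t)"
    using h by (intro hbi) auto
  then have "has_bochner_integral lborel (\<lambda>t. ?F {-pi<..-pi+h} (- (2 * pi) + 1 * t)) (LBINT t:{-pi<..-pi+h}. f t)"
    using lborel_has_bochner_integral_real_affine_iff[of 1 "?F {-pi<..-pi+h}" _ "- (2 * pi)"] by simp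
  moreover have "?F {-pi<..-pi+h} (- (2 * pi) + 1 * t) = ?F {pi<..pi+h} t" for t
    using per[of "t - 2 * pi"] by (auto simp: indicator_def)
  ultimately have "has_bochner_integral lborel (?F {pi<..pi+h}) (LBINT t:{-pi<..-pi+h}. f t)"
    by simp
  moreover have "{-pi+h<..pi} \<subseteq> {-pi<..pi}"
    using h by auto
  ultimately have "has_bochner_integral lborel (\<lambda>t. ?F {pi<..pi+h} t + ?F {-pi+h<..pi} t)
      ((LBINT t:{-pi<..-pi+h}. f t) + (LBINT t:{-pi+h<..pi}. f t))"
    by (intro has_bochner_integral_add hbi) auto
  then
  have "has_bochner_integral lborel (\<lambda>t. ?F {pi<..pi+h} t + ?F {-pi+h<..pi} t) (LBINT t:{-pi<..pi}. f t)"
    unfolding split .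
  moreover have "?F {pi<..pi+h} t + ?F {-pi+h<..pi} t = ?F {-pi+h<..pi+h} t" for t
    using h by (auto simp: indicator_def)
  ultimately have "has_bochner_integral lborel (?F {-pi+h<..pi+h}) (LBINT t:{-pi<..pi}. f t)"
    by simp
  then have "has_bochner_integral lborel (\<lambda>t. ?F {-pi+h<..pi+h} (h + 1 * t)) (LBINT t:{-pi<..pi}. f t)"
    using lborel_has_bochner_integral_real_affine_iff[of 1 "?F {-pi+h<..pi+h}" _ h] by simp
  moreover have "?F {-pi+h<..pi+h} (h + 1 * t) = indicator {-pi<..pi} t *\<^sub>R f (t + h)" for t
    by (auto simp: indicator_def add.commute)
  ultimately show ?thesis by simp
qed

lemma set_integral_interval_shift:
  fixes f :: "real \<Rightarrow> 'a::{banach, second_countable_topology}"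
  shows "(LBINT t:{a..b}. f t) = (LBINT t:{a - c..b - c}. f (t + c))"
proof -
  have "indicator {a..b} (c + 1 * t) *\<^sub>R f (c + 1 * t) = indicator {a - c..b - c} t *\<^sub>R f (t + c)" for t
    by (auto simp: indicator_def add.commute)
  then show ?thesis
    unfolding set_lebesgue_integral_def
    by (subst lborel_integral_real_affine[where c = 1 and t = c]) simp_all
qed

section \<open>Privalov's theorem\<close>

text \<open>This is 2 * pi times the Hilbert transform, regularised: the increment of \<phi> makes
  it absolutely convergent for Hoelder functions. The half-open period suits translations.\<close>

definition cot_integral :: "(real \<Rightarrow> 'a::{banach, second_countable_topology}) \<Rightarrow> real \<Rightarrow> 'a" where
  "cot_integral \<phi> \<alpha> = (LBINT t:{-pi<..pi}. cot (t / 2) *\<^sub>R (\<phi> (\<alpha> - t) - \<phi> \<alpha>))"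

text \<open>The outer cut b is free because the Hilbert transform uses b = pi and the sine kernel b
  = pi - \<epsilon>.\<close>

definition truncated_cot_integral ::
  "(real \<Rightarrow> 'a::{banach, second_countable_topology}) \<Rightarrow> real \<Rightarrow> real \<Rightarrow> real \<Rightarrow> 'a" where
  "truncated_cot_integral \<phi> \<alpha> a b =
     (LBINT t:{-b..-a}. cot (t / 2) *\<^sub>R \<phi> (\<alpha> - t)) + (LBINT t:{a..b}. cot (t / 2) *\<^sub>R \<phi> (\<alpha> - t))"

text \<open>Here 32 = 8 * 2 + 8 * 2 comes from two singular integrals over intervals of radius 3 *
  h, and 128 = 64 * 2 from the tail of \<bar>t\<bar> powr (\<gamma> - 2) beyond 2 * h. Integrability
  at 0 costs 1 / \<gamma> and integrability at infinity 1 / (1 - \<gamma>).\<close>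

definition privalov_const :: "real \<Rightarrow> real" where
  "privalov_const \<gamma> = 32 * 3 powr \<gamma> / \<gamma> + 128 * 2 powr (\<gamma> - 1) / (1 - \<gamma>)"

locale holder_periodic =
  fixes \<phi> :: "real \<Rightarrow> 'a::{banach, second_countable_topology}" and \<gamma> M :: real
  assumes gamma: "0 < \<gamma>" "\<gamma> < 1"
    and periodic: "\<phi> (x + 2 * pi) = \<phi> x"
    and holder: "norm (\<phi> s - \<phi> t) \<le> M * \<bar>s - t\<bar> powr \<gamma>"
begin

lemma M_nonneg: "0 \<le> M"
  using order_trans[OF norm_ge_zero holder[of 1 0]] by simp

lemma continuous: "continuous_on A \<phi>"
proof -
  have "isCont \<phi> x" for x
  proof -
    have "((\<lambda>y. M * \<bar>y - x\<bar> powr \<gamma>) \<longlongrightarrow> M * \<bar>x - x\<bar> powr \<gamma>) (at x)"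
      using gamma by (intro tendsto_intros) auto
    then have "((\<lambda>y. M * \<bar>y - x\<bar> powr \<gamma>) \<longlongrightarrow> 0) (at x)"
      by simp
    then have "((\<lambda>y. \<phi> y - \<phi> x) \<longlongrightarrow> 0) (at x)"
      by (rule Lim_null_comparison[OF always_eventually, rotated]) (use holder in auto)
    then show ?thesis
      by (simp add: isCont_def LIM_zero_iff)
  qed
  then show ?thesis
    by (simp add: continuous_at_imp_continuous_on)
qed

lemma measurable_phi [measurable]: "\<phi> \<in> borel_measurable borel"
  by (rule borel_measurable_continuous_onI[OF continuous])

lemma measurable_cot [measurable]: "(cot :: real \<Rightarrow> real) \<in> borel_measurable borel"
  unfolding cot_def[abs_def] by measurable

text \<open>The points s and s' are free so that the estimate covers the integrand at \<alpha> and
  also the translated one at \<alpha> + h, where t + h takes the place of t.\<close>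

lemma cot_integrand_le:
  assumes "\<bar>t\<bar> \<le> 4 * pi / 3" "\<bar>s - s'\<bar> = \<bar>t\<bar>"
  shows "norm (cot (t / 2) *\<^sub>R (\<phi> s - \<phi> s')) \<le> 8 * M * \<bar>t\<bar> powr (\<gamma> - 1)"
proof -
  have "norm (cot (t / 2) *\<^sub>R (\<phi> s - \<phi> s')) \<le> (8 / \<bar>t\<bar>) * (M * \<bar>t\<bar> powr \<gamma>)"
    using abs_cot_half_le[OF assms(1)] holder[of s s'] assms(2) M_nonneg
    unfolding norm_scaleR by (intro mult_mono) auto
  also have "\<dots> = 8 * M * \<bar>t\<bar> powr (\<gamma> - 1)"
    by (simp add: powr_diff)
  finally show ?thesis .
qed

lemma majorant_integrable:
  "integrable lborel (\<lambda>t. 8 * M * (indicator {-pi..pi} t * \<bar>t\<bar> powr (\<gamma> - 1)))"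
  using has_bochner_integral_powr_near[OF gamma(1) pi_gt_zero]
  by (intro integrable_mult_right) (simp add: has_bochner_integral_iff)

lemma indicator_integrand_le:
  "A \<subseteq> {-pi..pi} \<Longrightarrow> norm (indicator A t *\<^sub>R (cot (t / 2) *\<^sub>R (\<phi> (\<alpha> - t) - \<phi> \<alpha>)))
    \<le> 8 * M * (indicator {-pi..pi} t * \<bar>t\<bar> powr (\<gamma> - 1))"
proof (cases "t \<in> A")
  case True
  assume "A \<subseteq> {-pi..pi}"
  with True have "t \<in> {-pi..pi}" by blast
  moreover from this have "\<bar>t\<bar> \<le> 4 * pi / 3"
    using pi_gt_zero by auto
  ultimately show ?thesis
    using cot_integrand_le[of t "\<alpha> - t" \<alpha>] True by simp
qed (simp add: M_nonneg)

lemma cot_integrable: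
  assumes "A \<subseteq> {-pi..pi}" "A \<in> sets borel"
  shows "set_integrable lborel A (\<lambda>t. cot (t / 2) *\<^sub>R (\<phi> (\<alpha> - t) - \<phi> \<alpha>))"
  unfolding set_integrable_def
proof (rule Bochner_Integration.integrable_bound[OF majorant_integrable])
  show "(\<lambda>t. indicator A t *\<^sub>R (cot (t / 2) *\<^sub>R (\<phi> (\<alpha> - t) - \<phi> \<alpha>))) \<in> borel_measurable lborel"
    using assms(2) by measurable
  show "AE t in lborel. norm (indicator A t *\<^sub>R (cot (t / 2) *\<^sub>R (\<phi> (\<alpha> - t) - \<phi> \<alpha>)))
      \<le> norm (8 * M * (indicator {-pi..pi} t * \<bar>t\<bar> powr (\<gamma> - 1)))"
    using order_trans[OF indicator_integrand_le[OF assms(1)] abs_ge_self] by (intro AE_I2) simp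
qed

lemma cot_integrable_period:
  "set_integrable lborel {-pi<..pi} (\<lambda>t. cot (t / 2) *\<^sub>R (\<phi> (\<alpha> - t) - \<phi> \<alpha>))"
  by (rule cot_integrable) auto

lemma norm_cot_integral_le: "norm (cot_integral \<phi> \<alpha>) \<le> 16 * M * pi powr \<gamma> / \<gamma>"
proof -
  have "norm (cot_integral \<phi> \<alpha>) \<le> (\<integral>t. 8 * M * (indicator {-pi..pi} t * \<bar>t\<bar> powr (\<gamma> - 1)) \<partial>lborel)"
    unfolding cot_integral_def set_lebesgue_integral_def
    using cot_integrable_period[of \<alpha>]
    by (intro Bochner_Integration.integral_norm_bound_integral majorant_integrable indicator_integrand_le)
      (auto simp: set_integrable_def)
  also have "\<dots> = 8 * M * (2 * pi powr \<gamma> / \<gamma>)"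
    using has_bochner_integral_powr_near[OF gamma(1) pi_gt_zero] by (simp add: has_bochner_integral_iff)
  finally show ?thesis by (simp add: mult_ac)
qed

subsection \<open>Convergence of the truncated integrals\<close>

text \<open>The truncated domain is symmetric and the cotangent is odd, so the subtracted constant
  \<phi> \<alpha> contributes nothing.\<close>

lemma truncated_cot_integral_eq:
  assumes "0 < a" "b \<le> pi"
  shows "truncated_cot_integral \<phi> \<alpha> a b =
    (LBINT t:{-b..-a} \<union> {a..b}. cot (t / 2) *\<^sub>R (\<phi> (\<alpha> - t) - \<phi> \<alpha>))"
proof -
  let ?N = "{-b..-a}" and ?P = "{a..b}"
  have nz: "sin (t / 2) \<noteq> 0" if "t \<in> ?N \<union> ?P" for t
  proof -
    have "\<bar>t\<bar> \<le> 4 * pi / 3" "t \<noteq> 0"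
      using that assms pi_gt_zero by auto
    then show ?thesis
      using abs_sin_half_ge[of t] by auto
  qed
  have cc: "continuous_on ?N (\<lambda>t. cot (t / 2))" "continuous_on ?P (\<lambda>t. cot (t / 2))"
    unfolding cot_def using nz by (auto intro!: continuous_intros)
  have cp: "continuous_on A (\<lambda>t. \<phi> (\<alpha> - t))" for A
    by (rule continuous_on_compose2[OF continuous[of UNIV]]) (auto intro!: continuous_intros)
  have i1: "set_integrable lborel ?N (\<lambda>t. cot (t / 2) *\<^sub>R \<phi> (\<alpha> - t))"
    "set_integrable lborel ?P (\<lambda>t. cot (t / 2) *\<^sub>R \<phi> (\<alpha> - t))"
    by (intro borel_integrable_atLeastAtMost' continuous_intros cc cp)+
  have i2: "set_integrable lborel ?N (\<lambda>t. cot (t / 2) *\<^sub>R \<phi> \<alpha>)"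
    "set_integrable lborel ?P (\<lambda>t. cot (t / 2) *\<^sub>R \<phi> \<alpha>)"
    by (intro borel_integrable_atLeastAtMost' continuous_intros cc cp)+
  have "(LBINT t:?N \<union> ?P. cot (t / 2) *\<^sub>R \<phi> \<alpha>) = 0"
    unfolding set_lebesgue_integral_def
    by (rule integral_odd_eq_0) (auto simp: indicator_def cot_minus_arg)
  moreover have disj: "?N \<inter> ?P = {}"
    using assms by auto
  ultimately have "(LBINT t:?N. cot (t / 2) *\<^sub>R \<phi> \<alpha>) + (LBINT t:?P. cot (t / 2) *\<^sub>R \<phi> \<alpha>) = 0"
    by (simp add: set_integral_Un[OF _ i2])
  then have "truncated_cot_integral \<phi> \<alpha> a b
      = ((LBINT t:?N. cot (t / 2) *\<^sub>R \<phi> (\<alpha> - t)) - (LBINT t:?N. cot (t / 2) *\<^sub>R \<phi> \<alpha>))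
        + ((LBINT t:?P. cot (t / 2) *\<^sub>R \<phi> (\<alpha> - t)) - (LBINT t:?P. cot (t / 2) *\<^sub>R \<phi> \<alpha>))"
    by (simp add: truncated_cot_integral_def algebra_simps)
  also have "\<dots> = (LBINT t:?N. cot (t / 2) *\<^sub>R (\<phi> (\<alpha> - t) - \<phi> \<alpha>))
        + (LBINT t:?P. cot (t / 2) *\<^sub>R (\<phi> (\<alpha> - t) - \<phi> \<alpha>))"
    by (simp add: scaleR_diff_right set_integral_diff[OF i1(1) i2(1)] set_integral_diff[OF i1(2) i2(2)])
  also have "\<dots> = (LBINT t:?N \<union> ?P. cot (t / 2) *\<^sub>R (\<phi> (\<alpha> - t) - \<phi> \<alpha>))"
    by (rule set_integral_Un[OF disj, symmetric]) (use assms in \<open>auto intro!: cot_integrable\<close>)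
  finally show ?thesis .
qed

text \<open>Dominated convergence with a multiple of \<bar>t\<bar> powr (\<gamma> - 1) as majorant.
  The case c = 0 serves the Hilbert transform, c = 1 the sine kernel.\<close>

lemma truncated_cot_integral_tendsto:
  assumes "0 \<le> c"
  shows "((\<lambda>\<epsilon>. truncated_cot_integral \<phi> \<alpha> \<epsilon> (pi - c * \<epsilon>)) \<longlongrightarrow> cot_integral \<phi> \<alpha>) (at_right 0)"
proof (rule tendsto_at_right_sequentially[OF pi_gt_zero])
  fix X :: "nat \<Rightarrow> real"
  assume X: "\<And>n. 0 < X n" "X \<longlonglongrightarrow> 0"
  define S where "S n = {-(pi - c * X n)..- X n} \<union> {X n..pi - c * X n}" for n
  let ?g = "\<lambda>t. cot (t / 2) *\<^sub>R (\<phi> (\<alpha> - t) - \<phi> \<alpha>)"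
  have cX: "0 \<le> c * X n" for n
    using X(1)[of n] assms by simp
  have S: "S n \<subseteq> {-pi..pi}" for n
    using X(1)[of n] cX[of n] by (auto simp: S_def)
  have "(\<lambda>n. LBINT t. indicator (S n) t *\<^sub>R ?g t) \<longlonglongrightarrow> (LBINT t. indicator {-pi<..pi} t *\<^sub>R ?g t)"
  proof (rule integral_dominated_convergence[OF _ _ majorant_integrable])
    show "AE t in lborel. (\<lambda>n. indicator (S n) t *\<^sub>R ?g t) \<longlonglongrightarrow> indicator {-pi<..pi} t *\<^sub>R ?g t"
    proof (rule AE_I2)
      fix t :: real
      consider "t = 0 \<or> t = pi \<or> t = - pi" | "pi < \<bar>t\<bar>" | "0 < \<bar>t\<bar>" "\<bar>t\<bar> < pi"
        by linarith
      then show "(\<lambda>n. indicator (S n) t *\<^sub>R ?g t) \<longlonglongrightarrow> indicator {-pi<..pi} t *\<^sub>R ?g t"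
      proof cases
        \<comment> \<open>At pi and - pi the kernel vanishes, and at 0 it is 0 by the convention on
          division, so pointwise convergence holds there too.\<close>
        case 1
        then have "cot (t / 2) = 0" by (auto simp: cot_half_pi)
        then show ?thesis by simp
      next
        case 2
        then have "t \<notin> {-pi..pi}" "t \<notin> {-pi<..pi}" by auto
        then have "t \<notin> S n" "t \<notin> {-pi<..pi}" for n using S[of n] by auto
        then show ?thesis by simp
      next
        case 3
        have "\<forall>\<^sub>F n in sequentially. X n < \<bar>t\<bar>"
          using X(2) 3(1) by (rule order_tendstoD)
        moreover have "(\<lambda>n. pi - c * X n) \<longlonglongrightarrow> pi - c * 0"
          using X(2) by (intro tendsto_intros)
        then have "\<forall>\<^sub>F n in sequentially. \<bar>t\<bar> < pi - c * X n"
          using 3(2) by (intro order_tendstoD) auto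
        ultimately have "\<forall>\<^sub>F n in sequentially. indicator (S n) t *\<^sub>R ?g t = indicator {-pi<..pi} t *\<^sub>R ?g t"
          by eventually_elim (use 3 in \<open>auto simp: S_def indicator_def\<close>)
        then show ?thesis by (rule Topological_Spaces.tendsto_eventually)
      qed
    qed
    show "AE t in lborel. norm (indicator (S n) t *\<^sub>R ?g t)
        \<le> 8 * M * (indicator {-pi..pi} t * \<bar>t\<bar> powr (\<gamma> - 1))" for n
      by (rule AE_I2, rule indicator_integrand_le[OF S])
  qed (simp_all add: S_def)
  then show "(\<lambda>n. truncated_cot_integral \<phi> \<alpha> (X n) (pi - c * X n)) \<longlonglongrightarrow> cot_integral \<phi> \<alpha>"
    using X(1) cX by (simp add: truncated_cot_integral_eq S_def cot_integral_def set_lebesgue_integral_def)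
qed

subsection \<open>The Hoelder estimate\<close>

text \<open>Close to the singularities no cancellation is used: each integrand is bounded by itself,
  and \<bar>t + h\<bar> < 3 * h \<le> pi.\<close>

lemma shifted_integrand_near:
  assumes h: "0 < h" "h \<le> pi / 3" and t: "\<bar>t\<bar> < 2 * h"
  shows "norm (cot ((t + h) / 2) *\<^sub>R (\<phi> (\<alpha> - t) - \<phi> (\<alpha> + h)) - cot (t / 2) *\<^sub>R (\<phi> (\<alpha> - t) - \<phi> \<alpha>))
    \<le> 8 * M * \<bar>t + h\<bar> powr (\<gamma> - 1) + 8 * M * \<bar>t\<bar> powr (\<gamma> - 1)"
proof -
  have "\<bar>t + h\<bar> \<le> 4 * pi / 3" "\<bar>t\<bar> \<le> 4 * pi / 3"
    using h t by linarith+
  then show ?thesis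
    by (intro norm_triangle_le_diff add_mono cot_integrand_le) auto
qed

text \<open>The third term exchanges \<phi> \<alpha> for \<phi> (\<alpha> + h) in the second, so
  that the difference of the cotangents factors out and gains a power of \<bar>t\<bar>. Over a
  symmetric set this term, being odd in t, integrates to 0.\<close>

lemma shifted_integrand_far:
  assumes h: "0 < h" "h \<le> pi / 3" and t: "2 * h \<le> \<bar>t\<bar>" "\<bar>t\<bar> \<le> pi"
  shows "norm (cot ((t + h) / 2) *\<^sub>R (\<phi> (\<alpha> - t) - \<phi> (\<alpha> + h)) - cot (t / 2) *\<^sub>R (\<phi> (\<alpha> - t) - \<phi> \<alpha>)
      + cot (t / 2) *\<^sub>R (\<phi> (\<alpha> + h) - \<phi> \<alpha>))
    \<le> 64 * M * h * \<bar>t\<bar> powr (\<gamma> - 2)" (is "norm ?L \<le> _")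
proof -
  define x y where "x = \<bar>t\<bar>" and "y = \<bar>t + h\<bar>"
  have xy: "0 < x" "x / 2 \<le> y" "0 < y" "y \<le> 4 * pi / 3" "x \<le> 4 * pi / 3"
    unfolding x_def y_def using h t pi_gt_zero by linarith+
  have "?L = (cot ((t + h) / 2) - cot (t / 2)) *\<^sub>R (\<phi> (\<alpha> - t) - \<phi> (\<alpha> + h))"
    by (simp add: algebra_simps)
  then have "norm ?L = \<bar>cot ((t + h) / 2) - cot (t / 2)\<bar> * norm (\<phi> (\<alpha> - t) - \<phi> (\<alpha> + h))"
    by simp
  also have "\<dots> \<le> (32 * h / (y * x)) * (M * y powr \<gamma>)"
  proof (rule mult_mono)
    show "\<bar>cot ((t + h) / 2) - cot (t / 2)\<bar> \<le> 32 * h / (y * x)"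
      using abs_cot_diff_le[of "t + h" t] xy h by (auto simp: x_def y_def)
    have "\<bar>\<alpha> - t - (\<alpha> + h)\<bar> = y"
      by (simp add: y_def)
    then show "norm (\<phi> (\<alpha> - t) - \<phi> (\<alpha> + h)) \<le> M * y powr \<gamma>"
      using holder[of "\<alpha> - t" "\<alpha> + h"] by simp
  qed (use xy h in auto)
  also have "\<dots> = 32 * M * h * y powr (\<gamma> - 1) / x"
    using xy by (simp add: powr_diff)
  also have "\<dots> \<le> 32 * M * h * (2 * x powr (\<gamma> - 1)) / x"
  proof -
    \<comment> \<open>The exponent is negative, so the lower bound y \<ge> x / 2, a consequence of h
      \<le> \<bar>t\<bar> / 2, becomes an upper bound.\<close>
    have "y powr (\<gamma> - 1) \<le> (x / 2) powr (\<gamma> - 1)"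
      using xy gamma by (intro powr_mono2') auto
    also have "\<dots> = 2 powr (1 - \<gamma>) * x powr (\<gamma> - 1)"
      using xy by (simp add: powr_divide powr_diff)
    also have "\<dots> \<le> 2 * x powr (\<gamma> - 1)"
      using powr_mono[of "1 - \<gamma>" 1 2] gamma by (intro mult_right_mono) auto
    finally show ?thesis
      using xy h M_nonneg by (intro divide_right_mono mult_left_mono) auto
  qed
  also have "\<dots> = 64 * M * h * x powr (\<gamma> - 2)"
    using xy by (simp add: powr_diff power2_eq_square)
  finally show ?thesis
    by (simp add: x_def)
qed

text \<open>Translating the variable by h in the integral at \<alpha> + h makes both integrands
  contain \<phi> (\<alpha> - t). The region \<bar>t\<bar> < 2 * h is small and yields h powr
  \<gamma> from the singularities; on the rest the odd correction \<open>?k\<close> is added and the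
  tail estimate applies.\<close>

lemma cot_integral_holder_small:
  assumes h: "0 < h" "h \<le> pi / 3"
  shows "norm (cot_integral \<phi> (\<alpha> + h) - cot_integral \<phi> \<alpha>) \<le> privalov_const \<gamma> * M * h powr \<gamma>"
proof -
  define R where "R = {t. 2 * h \<le> \<bar>t\<bar> \<and> \<bar>t\<bar> \<le> pi}"
  have R: "R \<in> sets borel"
    unfolding R_def by measurable
  let ?I = "indicator {-pi<..pi} :: real \<Rightarrow> real"
  let ?f = "\<lambda>t. cot (t / 2) *\<^sub>R (\<phi> (\<alpha> + h - t) - \<phi> (\<alpha> + h))"
  let ?f' = "\<lambda>t. cot ((t + h) / 2) *\<^sub>R (\<phi> (\<alpha> - t) - \<phi> (\<alpha> + h))"
  let ?g = "\<lambda>t. cot (t / 2) *\<^sub>R (\<phi> (\<alpha> - t) - \<phi> \<alpha>)"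
  let ?k = "\<lambda>t. indicator R t *\<^sub>R (cot (t / 2) *\<^sub>R (\<phi> (\<alpha> + h) - \<phi> \<alpha>))"
  have "?f (t + 2 * pi) = ?f t" for t
  proof -
    have "cot ((t + 2 * pi) / 2) = cot (t / 2)"
      using cot_plus_pi[of "t / 2"] by (simp add: add_divide_distrib)
    moreover have "\<phi> (\<alpha> + h - (t + 2 * pi)) = \<phi> (\<alpha> + h - t)"
      using periodic[of "\<alpha> + h - (t + 2 * pi)"] by (simp add: algebra_simps)
    ultimately show ?thesis by simp
  qed
  moreover have "set_integrable lborel {-pi<..pi} ?f"
    by (rule cot_integrable_period)
  ultimately have "has_bochner_integral lborel (\<lambda>t. ?I t *\<^sub>R ?f (t + h)) (cot_integral \<phi> (\<alpha> + h))"
    unfolding cot_integral_def using h pi_gt_zero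
    by (intro has_bochner_integral_periodic_shift) auto
  then have f: "has_bochner_integral lborel (\<lambda>t. ?I t *\<^sub>R ?f' t) (cot_integral \<phi> (\<alpha> + h))"
    by simp
  have g: "has_bochner_integral lborel (\<lambda>t. ?I t *\<^sub>R ?g t) (cot_integral \<phi> \<alpha>)"
    using cot_integrable_period[of \<alpha>]
    by (auto simp: has_bochner_integral_iff cot_integral_def set_integrable_def set_lebesgue_integral_def)
  have "integrable lborel ?k"
  proof (rule Bochner_Integration.integrable_bound)
    show "integrable lborel (\<lambda>t. indicator {-pi..pi} t *\<^sub>R (8 / (2 * h) * norm (\<phi> (\<alpha> + h) - \<phi> \<alpha>)))"
      by (intro integrable_scaleR_left) (auto intro!: integrable_real_indicator)
    show "?k \<in> borel_measurable lborel"
      using R by measurable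
    show "AE t in lborel. norm (?k t)
        \<le> norm (indicator {-pi..pi} t *\<^sub>R (8 / (2 * h) * norm (\<phi> (\<alpha> + h) - \<phi> \<alpha>)))"
    proof (rule AE_I2)
      fix t :: real
      show "norm (?k t) \<le> norm (indicator {-pi..pi} t *\<^sub>R (8 / (2 * h) * norm (\<phi> (\<alpha> + h) - \<phi> \<alpha>)))"
      proof (cases "t \<in> R")
        case True
        then have t: "2 * h \<le> \<bar>t\<bar>" "\<bar>t\<bar> \<le> pi" by (auto simp: R_def)
        then have "\<bar>cot (t / 2)\<bar> \<le> 8 / \<bar>t\<bar>"
          using pi_gt_zero by (intro abs_cot_half_le) linarith
        also have "\<dots> \<le> 8 / (2 * h)"
          using t h by (intro frac_le) auto
        finally have "\<bar>cot (t / 2)\<bar> * norm (\<phi> (\<alpha> + h) - \<phi> \<alpha>) \<le> 8 / (2 * h) * norm (\<phi> (\<alpha> + h) - \<phi> \<alpha>)"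
          by (rule mult_right_mono) simp
        moreover have "t \<in> {-pi..pi}" using t by auto
        ultimately show ?thesis
          using True h by (simp add: abs_mult)
      qed simp
    qed
  qed
  moreover have "integral\<^sup>L lborel ?k = 0"
    by (rule integral_odd_eq_0) (auto simp: R_def indicator_def cot_minus_arg)
  ultimately have k: "has_bochner_integral lborel ?k 0"
    by (simp add: has_bochner_integral_iff)
  let ?D = "\<lambda>t. ?I t *\<^sub>R ?f' t - ?I t *\<^sub>R ?g t + ?k t"
  have D: "has_bochner_integral lborel ?D (cot_integral \<phi> (\<alpha> + h) - cot_integral \<phi> \<alpha>)"
    using has_bochner_integral_add[OF has_bochner_integral_diff[OF f g] k] by simp
  \<comment> \<open>The radius 3 * h contains both t and t + h when \<bar>t\<bar> < 2 * h.\<close>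
  let ?u = "\<lambda>t. indicator {-(3 * h)..3 * h} t * \<bar>t\<bar> powr (\<gamma> - 1)"
  let ?v = "\<lambda>t. indicator {t. 2 * h \<le> \<bar>t\<bar>} t * \<bar>t\<bar> powr (\<gamma> - 2)"
  let ?G = "\<lambda>t. 8 * M * ?u (h + 1 * t) + 8 * M * ?u t + 64 * M * h * ?v t"
  have u: "has_bochner_integral lborel ?u (2 * (3 * h) powr \<gamma> / \<gamma>)"
    using has_bochner_integral_powr_near[of \<gamma> "3 * h"] gamma h by simp
  then have u': "has_bochner_integral lborel (\<lambda>t. ?u (h + 1 * t)) (2 * (3 * h) powr \<gamma> / \<gamma>)"
    using lborel_has_bochner_integral_real_affine_iff[of 1 ?u _ h] by simp
  have v: "has_bochner_integral lborel ?v (2 * (2 * h) powr (\<gamma> - 1) / (1 - \<gamma>))"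
    using has_bochner_integral_powr_far[of \<gamma> "2 * h"] gamma h by simp
  have G: "has_bochner_integral lborel ?G (8 * M * (2 * (3 * h) powr \<gamma> / \<gamma>) + 8 * M * (2 * (3 * h) powr \<gamma> / \<gamma>)
      + 64 * M * h * (2 * (2 * h) powr (\<gamma> - 1) / (1 - \<gamma>)))"
    by (intro has_bochner_integral_add has_bochner_integral_mult_right u u' v)
  have le: "norm (?D t) \<le> ?G t" for t
  proof -
    have nonneg: "0 \<le> 8 * M * ?u (h + 1 * t)" "0 \<le> 8 * M * ?u t" "0 \<le> 64 * M * h * ?v t"
      using M_nonneg h by auto
    consider "t \<notin> {-pi<..pi}" | "t \<in> {-pi<..pi}" "\<bar>t\<bar> < 2 * h" | "t \<in> {-pi<..pi}" "2 * h \<le> \<bar>t\<bar>"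
      by linarith
    then show ?thesis
    proof cases
      case 1
      \<comment> \<open>For symmetry R contains - pi, which the half-open period omits; the
        cotangent is 0 there.\<close>
      then have "t = - pi \<or> t \<notin> R"
        by (auto simp: R_def)
      then have "?k t = 0"
        by (auto simp: cot_half_pi)
      then have "?D t = 0" using 1 by simp
      then show ?thesis using nonneg by simp
    next
      case 2
      then have eqs: "?D t = ?f' t - ?g t" "?u (h + 1 * t) = \<bar>t + h\<bar> powr (\<gamma> - 1)" "?u t = \<bar>t\<bar> powr (\<gamma> - 1)"
        using h by (auto simp: R_def indicator_def add.commute)
      have "norm (?D t) \<le> 8 * M * ?u (h + 1 * t) + 8 * M * ?u t"
        unfolding eqs by (rule shifted_integrand_near[OF h 2(2)])
      then show ?thesis
        using nonneg(3) by linarith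
    next
      case 3
      then have t: "2 * h \<le> \<bar>t\<bar>" "\<bar>t\<bar> \<le> pi" and eqs: "?v t = \<bar>t\<bar> powr (\<gamma> - 2)"
        "?D t = ?f' t - ?g t + cot (t / 2) *\<^sub>R (\<phi> (\<alpha> + h) - \<phi> \<alpha>)"
        by (auto simp: R_def indicator_def)
      have "norm (?D t) \<le> 64 * M * h * ?v t"
        unfolding eqs by (rule shifted_integrand_far[OF h t])
      then show ?thesis
        using nonneg(1,2) by linarith
    qed
  qed
  have "norm (integral\<^sup>L lborel ?D) \<le> integral\<^sup>L lborel ?G"
    using D G le by (intro Bochner_Integration.integral_norm_bound_integral)
      (auto intro: integrable.intros)
  then have "norm (cot_integral \<phi> (\<alpha> + h) - cot_integral \<phi> \<alpha>)
      \<le> 8 * M * (2 * (3 * h) powr \<gamma> / \<gamma>) + 8 * M * (2 * (3 * h) powr \<gamma> / \<gamma>)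
      + 64 * M * h * (2 * (2 * h) powr (\<gamma> - 1) / (1 - \<gamma>))"
    using D G by (simp add: has_bochner_integral_iff)
  also have "\<dots> = privalov_const \<gamma> * M * h powr \<gamma>"
  proof -
    have "(3 * h) powr \<gamma> = 3 powr \<gamma> * h powr \<gamma>" "h * (2 * h) powr (\<gamma> - 1) = 2 powr (\<gamma> - 1) * h powr \<gamma>"
      using h by (simp_all add: powr_mult powr_diff)
    then have "8 * M * (2 * (3 * h) powr \<gamma> / \<gamma>) + 8 * M * (2 * (3 * h) powr \<gamma> / \<gamma>)
      + 64 * M * (2 * (h * (2 * h) powr (\<gamma> - 1)) / (1 - \<gamma>)) = privalov_const \<gamma> * M * h powr \<gamma>"
      by (simp add: privalov_const_def algebra_simps)
    then show ?thesis by (simp add: mult_ac)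
  qed
  finally show ?thesis .
qed

theorem cot_integral_holder:
  "norm (cot_integral \<phi> \<alpha> - cot_integral \<phi> \<beta>) \<le> privalov_const \<gamma> * M * \<bar>\<alpha> - \<beta>\<bar> powr \<gamma>"
proof -
  have *: "norm (cot_integral \<phi> (\<alpha> + h) - cot_integral \<phi> \<alpha>) \<le> privalov_const \<gamma> * M * h powr \<gamma>"
    if "0 < h" for \<alpha> h
  proof (cases "h \<le> pi / 3")
    case True
    with that show ?thesis by (rule cot_integral_holder_small)
  next
    case False
    \<comment> \<open>For large h the uniform bound on each value is enough: pi < 3 * h turns it
      into the first summand of \<open>privalov_const\<close>.\<close>
    have "norm (cot_integral \<phi> (\<alpha> + h) - cot_integral \<phi> \<alpha>)
        \<le> 16 * M * pi powr \<gamma> / \<gamma> + 16 * M * pi powr \<gamma> / \<gamma>"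
      by (rule norm_triangle_le_diff[OF add_mono[OF norm_cot_integral_le norm_cot_integral_le]])
    also have "\<dots> = 32 / \<gamma> * M * pi powr \<gamma>"
      by simp
    also have "\<dots> \<le> 32 / \<gamma> * M * (3 * h) powr \<gamma>"
      using False gamma M_nonneg by (intro mult_left_mono powr_mono2) auto
    also have "\<dots> = (32 * 3 powr \<gamma> / \<gamma>) * (M * h powr \<gamma>)"
      using that by (simp add: powr_mult)
    also have "\<dots> \<le> privalov_const \<gamma> * (M * h powr \<gamma>)"
      unfolding privalov_const_def using gamma M_nonneg by (intro mult_right_mono) auto
    finally show ?thesis by (simp add: mult.assoc)
  qed
  consider "\<alpha> < \<beta>" | "\<alpha> = \<beta>" | "\<beta> < \<alpha>" by linarith
  then show ?thesis
  proof cases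
    case 1
    then show ?thesis using *[of "\<beta> - \<alpha>" \<alpha>] by (simp add: norm_minus_commute)
  next
    case 3
    then show ?thesis using *[of "\<alpha> - \<beta>" \<beta>] by simp
  qed simp
qed

end

section \<open>The Hilbert transform on Hoelder spaces\<close>

lemma hilbert_transform_eq:
  fixes \<phi> :: "real \<Rightarrow> 'k::{real_normed_field, banach, second_countable_topology}"
  assumes "holder_periodic \<phi> \<gamma> M"
  shows "hilbert_transform \<phi> \<alpha> = cot_integral \<phi> \<alpha> /\<^sub>R (2 * pi)"
proof -
  have "((\<lambda>\<epsilon>. truncated_cot_integral \<phi> \<alpha> \<epsilon> pi) \<longlongrightarrow> cot_integral \<phi> \<alpha>) (at_right 0)"
    using holder_periodic.truncated_cot_integral_tendsto[OF assms, of 0 \<alpha>] by simp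
  then show ?thesis
    unfolding hilbert_transform_def truncated_cot_integral_def inverse_tan_eq_cot
    by (simp add: tendsto_Lim)
qed

text \<open>The cuts at 0 and at the ends of the period have equal width, so translation by pi maps
  the truncated domain of the tangent part exactly onto that of the cotangent at \<alpha> - pi. No
  error term remains.\<close>

lemma truncated_sin_integral_eq:
  fixes \<phi> :: "real \<Rightarrow> 'k::{real_normed_field, banach, second_countable_topology}"
  assumes "holder_periodic \<phi> \<gamma> M" "0 < \<epsilon>"
  shows "truncated_sin_integral \<phi> \<alpha> \<epsilon> =
    (truncated_cot_integral \<phi> (\<alpha> - pi) \<epsilon> (pi - \<epsilon>) - truncated_cot_integral \<phi> \<alpha> \<epsilon> (pi - \<epsilon>)) /\<^sub>R 2"
proof -
  interpret holder_periodic \<phi> \<gamma> M by fact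
  let ?N = "{- pi + \<epsilon>..- \<epsilon>}" and ?P = "{\<epsilon>..pi - \<epsilon>}"
  let ?c = "\<lambda>t. cot (t / 2) *\<^sub>R \<phi> (\<alpha> - t)" and ?s = "\<lambda>t. tan (t / 2) *\<^sub>R \<phi> (\<alpha> - t)"
  have nz: "sin (t / 2) \<noteq> 0 \<and> cos (t / 2) \<noteq> 0" if "t \<in> ?N \<union> ?P" for t
  proof -
    have "\<bar>t\<bar> \<le> 4 * pi / 3" "t \<noteq> 0" "- (pi / 2) < t / 2" "t / 2 < pi / 2"
      using that assms(2) pi_gt_zero by auto
    then show ?thesis
      using abs_sin_half_ge[of t] cos_gt_zero_pi[of "t / 2"] by auto
  qed
  have cc: "continuous_on ?N (\<lambda>t. cot (t / 2))" "continuous_on ?P (\<lambda>t. cot (t / 2))"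
    "continuous_on ?N (\<lambda>t. tan (t / 2))" "continuous_on ?P (\<lambda>t. tan (t / 2))"
    unfolding cot_def tan_def using nz by (auto intro!: continuous_intros)
  have cp: "continuous_on A (\<lambda>t. \<phi> (\<alpha> - t))" for A
    by (rule continuous_on_compose2[OF continuous[of UNIV]]) (auto intro!: continuous_intros)
  have int: "set_integrable lborel ?N ?c" "set_integrable lborel ?P ?c"
    "set_integrable lborel ?N ?s" "set_integrable lborel ?P ?s"
    by (intro borel_integrable_atLeastAtMost' continuous_on_scaleR cc cp)+
  have eq: "\<phi> (\<alpha> - t) /\<^sub>R sin (- t) = (- 1 / 2) *\<^sub>R (?c t + ?s t)" if "t \<in> ?N \<union> ?P" for t
  proof -
    have "inverse (sin (- t)) = (- 1 / 2) * (cot (t / 2) + tan (t / 2))"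
      using inverse_sin_eq_cot_plus_tan[of t] nz[OF that] by simp
    then show ?thesis
      by (simp only: scaleR_scaleR scaleR_add_left[symmetric])
  qed
  have N: "(LBINT t:?N. \<phi> (\<alpha> - t) /\<^sub>R sin (- t)) = (LBINT t:?N. (- 1 / 2) *\<^sub>R (?c t + ?s t))"
    by (rule set_lebesgue_integral_cong) (use eq in auto)
  have P: "(LBINT t:?P. \<phi> (\<alpha> - t) /\<^sub>R sin (- t)) = (LBINT t:?P. (- 1 / 2) *\<^sub>R (?c t + ?s t))"
    by (rule set_lebesgue_integral_cong) (use eq in auto)
  have "truncated_sin_integral \<phi> \<alpha> \<epsilon>
      = (- 1 / 2) *\<^sub>R (((LBINT t:?N. ?c t) + (LBINT t:?P. ?c t)) + ((LBINT t:?N. ?s t) + (LBINT t:?P. ?s t)))"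
    unfolding truncated_sin_integral_def N P set_integral_scaleR_right
      set_integral_add(2)[OF int(1,3)] set_integral_add(2)[OF int(2,4)]
    by (simp only: scaleR_add_right add_ac)
  \<comment> \<open>Moving the left interval onto the right one produces \<phi> (\<alpha> + pi - t),
    which periodicity turns into \<phi> (\<alpha> - pi - t).\<close>
  moreover have "(LBINT t:?N. ?s t) = - (LBINT t:?P. cot (t / 2) *\<^sub>R \<phi> (\<alpha> - pi - t))"
  proof -
    have *: "?s (t + - pi) = - (cot (t / 2) *\<^sub>R \<phi> (\<alpha> - pi - t))" for t
      using tan_plus_half_pi(2)[of "t / 2"] periodic[of "\<alpha> - pi - t"]
      by (simp add: diff_divide_distrib algebra_simps)
    have "{- pi + \<epsilon> - - pi..- \<epsilon> - - pi} = ?P" by auto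
    with * show ?thesis
      by (subst set_integral_interval_shift[where c = "- pi"]) (simp add: set_lebesgue_integral_def)
  qed
  moreover have "(LBINT t:?P. ?s t) = - (LBINT t:?N. cot (t / 2) *\<^sub>R \<phi> (\<alpha> - pi - t))"
  proof -
    have *: "?s (t + pi) = - (cot (t / 2) *\<^sub>R \<phi> (\<alpha> - pi - t))" for t
      using tan_plus_half_pi(1)[of "t / 2"] by (simp add: add_divide_distrib algebra_simps)
    have "{\<epsilon> - pi..pi - \<epsilon> - pi} = ?N" by auto
    with * show ?thesis
      by (subst set_integral_interval_shift[where c = pi]) (simp add: set_lebesgue_integral_def)
  qed
  ultimately show ?thesis
    by (simp add: truncated_cot_integral_def algebra_simps)
qed

lemma truncated_sin_integral_tendsto:
  fixes \<phi> :: "real \<Rightarrow> 'k::{real_normed_field, banach, second_countable_topology}"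
  assumes "holder_periodic \<phi> \<gamma> M"
  shows "(truncated_sin_integral \<phi> \<alpha> \<longlongrightarrow>
    pi *\<^sub>R (hilbert_transform \<phi> (\<alpha> - pi) - hilbert_transform \<phi> \<alpha>)) (at_right 0)"
proof -
  have lim: "((\<lambda>\<epsilon>. truncated_cot_integral \<phi> \<beta> \<epsilon> (pi - \<epsilon>)) \<longlongrightarrow> cot_integral \<phi> \<beta>) (at_right 0)" for \<beta>
    using holder_periodic.truncated_cot_integral_tendsto[OF assms, of 1 \<beta>] by simp
  have 1: "((\<lambda>\<epsilon>. (truncated_cot_integral \<phi> (\<alpha> - pi) \<epsilon> (pi - \<epsilon>) - truncated_cot_integral \<phi> \<alpha> \<epsilon> (pi - \<epsilon>)) /\<^sub>R 2)
      \<longlongrightarrow> (cot_integral \<phi> (\<alpha> - pi) - cot_integral \<phi> \<alpha>) /\<^sub>R 2) (at_right 0)"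
    by (intro tendsto_intros lim)
  have 2: "\<forall>\<^sub>F \<epsilon> in at_right 0. (truncated_cot_integral \<phi> (\<alpha> - pi) \<epsilon> (pi - \<epsilon>)
      - truncated_cot_integral \<phi> \<alpha> \<epsilon> (pi - \<epsilon>)) /\<^sub>R 2 = truncated_sin_integral \<phi> \<alpha> \<epsilon>"
    using eventually_at_right_less[of 0]
    by eventually_elim (simp add: truncated_sin_integral_eq[OF assms])
  have 3: "(cot_integral \<phi> (\<alpha> - pi) - cot_integral \<phi> \<alpha>) /\<^sub>R 2
      = pi *\<^sub>R (hilbert_transform \<phi> (\<alpha> - pi) - hilbert_transform \<phi> \<alpha>)"
    by (simp add: hilbert_transform_eq[OF assms] scaleR_diff_right)
  show ?thesis
    using Lim_transform_eventually[OF 1 2] unfolding 3 .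
qed

section \<open>Linearity and boundedness of the Hilbert transform on Hoelder spaces\<close>

lemma holder_space_holder_periodic:
  fixes \<phi> :: "real \<Rightarrow> 'k::{real_normed_field, banach, second_countable_topology}"
  assumes "\<phi> \<in> vcarrier (holder_space \<gamma>)" "0 < \<gamma>" "\<gamma> < 1"
  shows "holder_periodic \<phi> \<gamma> (seminorm (holder_space \<gamma>) \<phi>)"
proof
  have bdd: "bdd_above (holder_quotients \<gamma> \<phi>)" and per: "\<phi> (x + 2 * pi) = \<phi> x" for x
    using assms(1) by (auto simp: holder_space_def)
  then show "\<phi> (x + 2 * pi) = \<phi> x" for x by simp
  show "norm (\<phi> s - \<phi> t) \<le> seminorm (holder_space \<gamma>) \<phi> * \<bar>s - t\<bar> powr \<gamma>" for s t
  proof (cases "s = t")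
    case False
    have "norm (\<phi> s - \<phi> t) / \<bar>s - t\<bar> powr \<gamma> \<le> Sup (holder_quotients \<gamma> \<phi>)"
      using False by (intro cSup_upper bdd) (auto simp: holder_quotients_def)
    then show ?thesis
      using False by (simp add: holder_space_def pos_divide_le_eq)
  qed simp
qed (use assms in auto)

lemma holder_spaceI:
  assumes per: "\<And>x. \<phi> (x + 2 * pi) = \<phi> x"
    and le: "\<And>s t. norm (\<phi> s - \<phi> t) \<le> K * \<bar>s - t\<bar> powr \<gamma>"
  shows "\<phi> \<in> vcarrier (holder_space \<gamma>)" "seminorm (holder_space \<gamma>) \<phi> \<le> K"
proof -
  have *: "x \<le> K" if "x \<in> holder_quotients \<gamma> \<phi>" for x
    using that le by (auto simp: holder_quotients_def pos_divide_le_eq)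
  then show "\<phi> \<in> vcarrier (holder_space \<gamma>)"
    using per by (auto simp: holder_space_def bdd_above_def)
  \<comment> \<open>Any two distinct points show that the supremum is over a nonempty set.\<close>
  have "norm (\<phi> 1 - \<phi> 0) / \<bar>1 - 0\<bar> powr \<gamma> \<in> holder_quotients \<gamma> \<phi>"
    unfolding holder_quotients_def by (intro CollectI exI[of _ 1] exI[of _ 0]) simp
  then have "holder_quotients \<gamma> \<phi> \<noteq> {}" by blast
  then show "seminorm (holder_space \<gamma>) \<phi> \<le> K"
    using * by (auto simp: holder_space_def intro: cSup_least)
qed

lemma holder_space_add:
  fixes \<phi> \<psi> :: "real \<Rightarrow> 'k::{real_normed_field, banach, second_countable_topology}"
  assumes "\<phi> \<in> vcarrier (holder_space \<gamma>)" "\<psi> \<in> vcarrier (holder_space \<gamma>)" "0 < \<gamma>" "\<gamma> < 1"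
  shows "(\<lambda>x. \<phi> x + \<psi> x) \<in> vcarrier (holder_space \<gamma>)"
proof -
  interpret p: holder_periodic \<phi> \<gamma> "seminorm (holder_space \<gamma>) \<phi>"
    by (rule holder_space_holder_periodic) fact+
  interpret q: holder_periodic \<psi> \<gamma> "seminorm (holder_space \<gamma>) \<psi>"
    by (rule holder_space_holder_periodic) fact+
  show ?thesis
  proof (rule holder_spaceI)
    show "norm (\<phi> s + \<psi> s - (\<phi> t + \<psi> t))
        \<le> (seminorm (holder_space \<gamma>) \<phi> + seminorm (holder_space \<gamma>) \<psi>) * \<bar>s - t\<bar> powr \<gamma>" for s t
      using norm_triangle_ineq[of "\<phi> s - \<phi> t" "\<psi> s - \<psi> t"] p.holder[of s t] q.holder[of s t]
      by (simp add: algebra_simps)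
  qed (simp add: p.periodic q.periodic)
qed

lemma holder_space_smult:
  fixes \<phi> :: "real \<Rightarrow> 'k::{real_normed_field, banach, second_countable_topology}"
  assumes "\<phi> \<in> vcarrier (holder_space \<gamma>)" "0 < \<gamma>" "\<gamma> < 1"
  shows "(\<lambda>x. c * \<phi> x) \<in> vcarrier (holder_space \<gamma>)"
    "seminorm (holder_space \<gamma>) (\<lambda>x. c * \<phi> x) \<le> norm c * seminorm (holder_space \<gamma>) \<phi>"
proof -
  interpret holder_periodic \<phi> \<gamma> "seminorm (holder_space \<gamma>) \<phi>"
    by (rule holder_space_holder_periodic) fact+
  have "norm (c * \<phi> s - c * \<phi> t) \<le> (norm c * seminorm (holder_space \<gamma>) \<phi>) * \<bar>s - t\<bar> powr \<gamma>" for s t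
    using mult_left_mono[OF holder[of s t] norm_ge_zero[of c]]
    by (simp add: right_diff_distrib[symmetric] norm_mult mult.assoc)
  then show "(\<lambda>x. c * \<phi> x) \<in> vcarrier (holder_space \<gamma>)"
    "seminorm (holder_space \<gamma>) (\<lambda>x. c * \<phi> x) \<le> norm c * seminorm (holder_space \<gamma>) \<phi>"
    by (auto intro!: holder_spaceI simp: periodic)
qed

lemma hilbert_transform_add:
  fixes \<phi> \<psi> :: "real \<Rightarrow> 'k::{real_normed_field, banach, second_countable_topology}"
  assumes "\<phi> \<in> vcarrier (holder_space \<gamma>)" "\<psi> \<in> vcarrier (holder_space \<gamma>)" "0 < \<gamma>" "\<gamma> < 1"
  shows "hilbert_transform (\<lambda>x. \<phi> x + \<psi> x) \<alpha> = hilbert_transform \<phi> \<alpha> + hilbert_transform \<psi> \<alpha>"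
proof -
  note p = holder_space_holder_periodic[OF assms(1,3,4)]
    and q = holder_space_holder_periodic[OF assms(2-4)]
    and pq = holder_space_holder_periodic[OF holder_space_add[OF assms] assms(3,4)]
  have "cot_integral (\<lambda>x. \<phi> x + \<psi> x) \<alpha> = cot_integral \<phi> \<alpha> + cot_integral \<psi> \<alpha>"
    unfolding cot_integral_def
    by (subst set_integral_add(2)[OF holder_periodic.cot_integrable_period[OF p]
          holder_periodic.cot_integrable_period[OF q], symmetric])
      (simp add: algebra_simps)
  then show ?thesis
    by (simp add: hilbert_transform_eq[OF p] hilbert_transform_eq[OF q] hilbert_transform_eq[OF pq]
        scaleR_add_right)
qed

lemma hilbert_transform_smult:
  fixes \<phi> :: "real \<Rightarrow> 'k::{real_normed_field, banach, second_countable_topology}"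
  assumes "\<phi> \<in> vcarrier (holder_space \<gamma>)" "0 < \<gamma>" "\<gamma> < 1"
  shows "hilbert_transform (\<lambda>x. c * \<phi> x) \<alpha> = c * hilbert_transform \<phi> \<alpha>"
proof -
  note p = holder_space_holder_periodic[OF assms]
    and cp = holder_space_holder_periodic[OF holder_space_smult(1)[OF assms] assms(2,3)]
  have "cot_integral (\<lambda>x. c * \<phi> x) \<alpha> = c * cot_integral \<phi> \<alpha>"
    unfolding cot_integral_def set_integral_mult_right[symmetric]
    by (simp add: right_diff_distrib[symmetric])
  then show ?thesis
    by (simp add: hilbert_transform_eq[OF p] hilbert_transform_eq[OF cp])
qed

theorem privalov:
  fixes \<phi> :: "real \<Rightarrow> 'k::{real_normed_field, banach, second_countable_topology}"
  assumes "\<phi> \<in> vcarrier (holder_space \<gamma>)" "0 < \<gamma>" "\<gamma> < 1"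
  shows "hilbert_transform \<phi> \<in> vcarrier (holder_space \<gamma>)"
    "seminorm (holder_space \<gamma>) (hilbert_transform \<phi>)
      \<le> privalov_const \<gamma> / (2 * pi) * seminorm (holder_space \<gamma>) \<phi>"
proof -
  note p = holder_space_holder_periodic[OF assms]
  interpret holder_periodic \<phi> \<gamma> "seminorm (holder_space \<gamma>) \<phi>" by (rule p)
  note H = hilbert_transform_eq[OF p]
  have "\<phi> (x + 2 * pi - t) = \<phi> (x - t)" for x t
    using periodic[of "x - t"] by (simp add: algebra_simps)
  then have per: "hilbert_transform \<phi> (x + 2 * pi) = hilbert_transform \<phi> x" for x
    by (simp add: H cot_integral_def periodic)
  have "norm (hilbert_transform \<phi> s - hilbert_transform \<phi> t)
      \<le> (privalov_const \<gamma> / (2 * pi) * seminorm (holder_space \<gamma>) \<phi>) * \<bar>s - t\<bar> powr \<gamma>" for s t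
  proof -
    have "norm (hilbert_transform \<phi> s - hilbert_transform \<phi> t)
        = norm (cot_integral \<phi> s - cot_integral \<phi> t) / (2 * pi)"
      unfolding H scaleR_diff_right[symmetric] norm_scaleR by (simp add: divide_simps)
    also have "\<dots> \<le> privalov_const \<gamma> * seminorm (holder_space \<gamma>) \<phi> * \<bar>s - t\<bar> powr \<gamma> / (2 * pi)"
      by (intro divide_right_mono cot_integral_holder) simp
    finally show ?thesis by simp
  qed
  with per show "hilbert_transform \<phi> \<in> vcarrier (holder_space \<gamma>)"
    "seminorm (holder_space \<gamma>) (hilbert_transform \<phi>)
      \<le> privalov_const \<gamma> / (2 * pi) * seminorm (holder_space \<gamma>) \<phi>"
    by (intro holder_spaceI; blast)+
qed

section \<open>The operator norm of the Hilbert transform\<close>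

context
  fixes \<gamma> :: real and N :: real
  assumes gamma: "0 < \<gamma>" "\<gamma> < 1"
  defines "N \<equiv> op_norm (holder_space \<gamma>) (holder_space \<gamma>)
    (hilbert_transform :: (real \<Rightarrow> 'k::{real_normed_field, banach, second_countable_topology}) \<Rightarrow> real \<Rightarrow> 'k)"
begin

lemma hilbert_op_norm_upper:
  fixes \<phi> :: "real \<Rightarrow> 'k"
  assumes "\<phi> \<in> vcarrier (holder_space \<gamma>)" "seminorm (holder_space \<gamma>) \<phi> \<le> 1"
  shows "seminorm (holder_space \<gamma>) (hilbert_transform \<phi>) \<le> N"
  unfolding N_def op_norm_def
proof (rule cSup_upper)
  have "0 \<le> privalov_const \<gamma> / (2 * pi)"
    using gamma by (simp add: privalov_const_def)
  then have "seminorm (holder_space \<gamma>) (hilbert_transform \<psi>) \<le> privalov_const \<gamma> / (2 * pi) * 1"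
    if "\<psi> \<in> vcarrier (holder_space \<gamma>)" "seminorm (holder_space \<gamma>) \<psi> \<le> 1" for \<psi> :: "real \<Rightarrow> 'k"
    using privalov(2)[OF that(1) gamma] mult_left_mono[OF that(2)] by (metis order_trans)
  then show "bdd_above {seminorm (holder_space \<gamma>) (hilbert_transform \<psi>) |\<psi> :: real \<Rightarrow> 'k.
      \<psi> \<in> vcarrier (holder_space \<gamma>) \<and> seminorm (holder_space \<gamma>) \<psi> \<le> 1}"
    by (intro bdd_aboveI) blast
qed (use assms in auto)

text \<open>The supremum ranges over the unit ball, so \<phi> is divided by its seminorm m.
  Functions with m = 0 cannot be normalised.\<close>

lemma seminorm_hilbert_transform_le:
  fixes \<phi> :: "real \<Rightarrow> 'k"
  assumes "\<phi> \<in> vcarrier (holder_space \<gamma>)"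
  shows "seminorm (holder_space \<gamma>) (hilbert_transform \<phi>) \<le> N * seminorm (holder_space \<gamma>) \<phi>"
proof -
  define m where "m = seminorm (holder_space \<gamma>) \<phi>"
  interpret holder_periodic \<phi> \<gamma> m
    unfolding m_def by (rule holder_space_holder_periodic[OF assms gamma])
  show ?thesis
  proof (cases "m = 0")
    \<comment> \<open>The explicit Privalov bound forces the seminorm of the transform to be 0 as
      well.\<close>
    case True
    then show ?thesis
      using privalov(2)[OF assms gamma] by (simp add: m_def)
  next
    case False
    with M_nonneg have m: "0 < m" by simp
    define \<psi> where "\<psi> = (\<lambda>x. of_real (1 / m) * \<phi> x)"
    have "seminorm (holder_space \<gamma>) \<psi> \<le> norm (of_real (1 / m) :: 'k) * m"
      unfolding \<psi>_def m_def by (rule holder_space_smult[OF assms gamma])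
    then have psi: "\<psi> \<in> vcarrier (holder_space \<gamma>)" "seminorm (holder_space \<gamma>) \<psi> \<le> 1"
      using m holder_space_smult(1)[OF assms gamma, of "of_real (1 / m)"]
      by (auto simp: \<psi>_def norm_divide)
    have "hilbert_transform \<phi> = (\<lambda>x. of_real m * hilbert_transform \<psi> x)"
      using hilbert_transform_smult[OF assms gamma, of "of_real (1 / m)"] m by (auto simp: \<psi>_def)
    then have "seminorm (holder_space \<gamma>) (hilbert_transform \<phi>)
        \<le> norm (of_real m :: 'k) * seminorm (holder_space \<gamma>) (hilbert_transform \<psi>)"
      using holder_space_smult(2)[OF privalov(1)[OF psi(1) gamma] gamma, of "of_real m"]
      by (simp only:)
    also have "\<dots> \<le> m * N"
      using m hilbert_op_norm_upper[OF psi] by (simp add: mult_left_mono)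
    finally show ?thesis by (simp add: m_def mult.commute)
  qed
qed

lemma hilbert_op_norm_nonneg: "0 \<le> N"
proof -
  have z: "(\<lambda>_. 0 :: 'k) \<in> vcarrier (holder_space \<gamma>)" "seminorm (holder_space \<gamma>) (\<lambda>_. 0 :: 'k) \<le> 0"
    by (rule holder_spaceI[where K = 0]; simp)+
  have "0 \<le> seminorm (holder_space \<gamma>) (hilbert_transform (\<lambda>_. 0 :: 'k))"
    by (rule holder_periodic.M_nonneg[OF holder_space_holder_periodic[OF privalov(1)[OF z(1) gamma] gamma]])
  then show ?thesis
    using hilbert_op_norm_upper[OF z(1)] z(2) by linarith
qed

lemma norm_hilbert_transform_diff_le:
  fixes \<phi> :: "real \<Rightarrow> 'k"
  assumes "\<phi> \<in> vcarrier (holder_space \<gamma>)"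
  shows "norm (hilbert_transform \<phi> s - hilbert_transform \<phi> t)
    \<le> N * seminorm (holder_space \<gamma>) \<phi> * \<bar>s - t\<bar> powr \<gamma>"
  using holder_periodic.holder[OF holder_space_holder_periodic[OF privalov(1)[OF assms gamma] gamma], of s t]
    mult_right_mono[OF seminorm_hilbert_transform_le[OF assms] powr_ge_zero[of "\<bar>s - t\<bar>" \<gamma>]]
  by (rule order_trans)

end


section \<open>The operator on elementary tensors\<close>

lemma integrable_functions_simps:
  "vcarrier integrable_functions = {f. integrable (lebesgue_on {0..}) f}"
  "vadd integrable_functions f g = (\<lambda>x. f x + g x)"
  "vsmult integrable_functions c f = (\<lambda>x. c * f x)"
  "seminorm integrable_functions f = (\<integral>x. norm (f x) \<partial>lebesgue_on {0..})"
  by (simp_all add: integrable_functions_def)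

lemma seminormed_vector_space_integrable_functions:
  "seminormed_vector_space (integrable_functions ::
    ('k::{real_normed_field, banach, second_countable_topology}, real \<Rightarrow> 'k) seminormed_space)"
proof
  fix f g :: "real \<Rightarrow> 'k"
  assume "f \<in> vcarrier integrable_functions" "g \<in> vcarrier integrable_functions"
  then have fg: "integrable (lebesgue_on {0..}) f" "integrable (lebesgue_on {0..}) g"
    by (simp_all add: integrable_functions_simps)
  have "(\<integral>x. norm (f x + g x) \<partial>lebesgue_on {0..}) \<le> (\<integral>x. norm (f x) + norm (g x) \<partial>lebesgue_on {0..})"
    using fg by (intro integral_mono) (auto intro: norm_triangle_ineq)
  then show "seminorm integrable_functions (vadd integrable_functions f g)
      \<le> seminorm integrable_functions f + seminorm integrable_functions g"
    using fg by (simp add: integrable_functions_simps)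
qed (auto simp: integrable_functions_simps norm_mult algebra_simps)

lemma functional_bound_integral:
  "functional_bound integrable_functions
    (\<lambda>f. \<integral>x. (f x :: 'k::{real_normed_field, banach, second_countable_topology}) \<partial>lebesgue_on {0..}) 1"
  by (auto simp: functional_bound_def integrable_functions_simps)

text \<open>The integral is bounded by the seminorm, hence the same for all representatives,
  including the chosen one.\<close>

lemma functional_bound_L1_integral:
  "functional_bound L1 (L1_integral :: _ \<Rightarrow> 'k::{real_normed_field, banach, second_countable_topology}) 1"
proof -
  interpret seminormed_vector_space "integrable_functions :: ('k, real \<Rightarrow> 'k) seminormed_space"
    by (rule seminormed_vector_space_integrable_functions)
  show ?thesis
    unfolding L1_def
    by (rule functional_bound_null_quotient[OF functional_bound_integral])
      (simp add: L1_integral_def functional_bound_null_class[OF functional_bound_integral _ some_null_class])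
qed

lemma seminormed_vector_space_L1:
  "seminormed_vector_space (L1 ::
    ('k::{real_normed_field, banach, second_countable_topology}, (real \<Rightarrow> 'k) set) seminormed_space)"
  unfolding L1_def
  by (rule seminormed_vector_space.seminormed_vector_space_null_quotient[OF
        seminormed_vector_space_integrable_functions])

lemma holder_even_simps:
  "vcarrier (holder_even \<gamma>) = {\<phi> \<in> vcarrier (holder_space \<gamma>). \<forall>x. \<phi> (- x) = \<phi> x}"
  "vadd (holder_even \<gamma>) \<phi> \<psi> = (\<lambda>x. \<phi> x + \<psi> x)"
  "vsmult (holder_even \<gamma>) c \<phi> = (\<lambda>x. c * \<phi> x)"
  "seminorm (holder_even \<gamma>) = seminorm (holder_space \<gamma>)"
  by (simp_all add: holder_even_def holder_space_def)

lemma K2_elem_eq: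
  assumes "\<phi> \<in> vcarrier (holder_space \<gamma>)" "0 < \<gamma>" "\<gamma> < 1"
  shows "K2_elem \<alpha> A \<phi> = L1_integral A * (hilbert_transform \<phi> (\<alpha> - pi) - hilbert_transform \<phi> \<alpha>)"
  using tendsto_Lim[OF _ truncated_sin_integral_tendsto[OF holder_space_holder_periodic[OF assms]]]
  by (simp add: K2_elem_def)

text \<open>\<open>Lim\<close> is linear only where limits exist. Linearity in the second argument
  is therefore read off the Hilbert transform, itself expressed by convergent integrals.\<close>

lemma bilinear_form_K2_elem:
  assumes "0 < \<gamma>" "\<gamma> < 1"
  shows "bilinear_form L1 (holder_even \<gamma>)
    (K2_elem \<alpha> :: _ \<Rightarrow> _ \<Rightarrow> 'k::{real_normed_field, banach, second_countable_topology})"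
  using functional_bound_L1_integral[where 'k = 'k]
  by (simp add: bilinear_form_def functional_bound_def holder_even_simps K2_elem_eq[OF _ assms]
      holder_space_add[OF _ _ assms] holder_space_smult(1)[OF _ assms]
      hilbert_transform_add[OF _ _ assms] hilbert_transform_smult[OF _ assms] algebra_simps)

lemma norm_K2_elem_le:
  fixes \<phi> :: "real \<Rightarrow> 'k::{real_normed_field, banach, second_countable_topology}"
  assumes "A \<in> vcarrier L1" "\<phi> \<in> vcarrier (holder_even \<gamma>)" "0 < \<gamma>" "\<gamma> < 1"
  shows "norm (K2_elem \<alpha> A \<phi>)
    \<le> op_norm (holder_space \<gamma>) (holder_space \<gamma>) (hilbert_transform :: (real \<Rightarrow> 'k) \<Rightarrow> real \<Rightarrow> 'k)
      * pi powr \<gamma> * (seminorm L1 A * seminorm (holder_even \<gamma>) \<phi>)"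
    (is "_ \<le> ?N * _ * _")
proof -
  have phi: "\<phi> \<in> vcarrier (holder_space \<gamma>)"
    using assms(2) by (simp add: holder_even_simps)
  have "norm (K2_elem \<alpha> A \<phi>)
      = norm (L1_integral A) * norm (hilbert_transform \<phi> (\<alpha> - pi) - hilbert_transform \<phi> \<alpha>)"
    by (simp add: K2_elem_eq[OF phi assms(3,4)] norm_mult)
  also have "\<dots> \<le> seminorm L1 A * (?N * seminorm (holder_space \<gamma>) \<phi> * pi powr \<gamma>)"
  proof (rule mult_mono)
    show "norm (L1_integral A) \<le> seminorm L1 A"
      using functional_bound_L1_integral assms(1) by (auto simp: functional_bound_def)
    then show "0 \<le> seminorm L1 A"
      using norm_ge_zero order_trans by blast
    \<comment> \<open>The power of pi is the distance between the two evaluation points.\<close>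
    show "norm (hilbert_transform \<phi> (\<alpha> - pi) - hilbert_transform \<phi> \<alpha>)
        \<le> ?N * seminorm (holder_space \<gamma>) \<phi> * pi powr \<gamma>"
      using norm_hilbert_transform_diff_le[OF assms(3,4) phi, of "\<alpha> - pi" \<alpha>] by simp
  qed simp
  finally show ?thesis
    by (simp add: holder_even_simps mult_ac)
qed

theorem theorem7:
  fixes \<gamma> \<alpha> :: real
    and E :: "('k::{real_normed_field, banach, second_countable_topology},
       (nat \<Rightarrow> ('k, (real \<Rightarrow> 'k) set, real \<Rightarrow> 'k) tensor) set) seminormed_space"
  defines "E \<equiv> proj_tensor L1 (holder_even \<gamma>)"
  assumes "0 < \<gamma>" and "\<gamma> < 1" and "\<alpha> \<in> {-pi..pi}"
  shows "bounded_linear_functional E (\<lambda>\<phi>. K2 \<gamma> \<phi> \<alpha>) \<and>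
    op_norm E scalars (\<lambda>\<phi>. K2 \<gamma> \<phi> \<alpha>) \<le>
      inverse \<gamma> * pi powr (\<gamma> - 1) +
      op_norm (holder_space \<gamma>) (holder_space \<gamma>)
        (hilbert_transform :: (real \<Rightarrow> 'k) \<Rightarrow> real \<Rightarrow> 'k) * (2 * pi) powr \<gamma> \<and>
    (\<forall>\<phi>\<^sub>1 \<in> vcarrier L1. \<forall>\<phi>\<^sub>2 \<in> vcarrier (holder_even \<gamma>). \<exists>l :: 'k.
       (truncated_sin_integral \<phi>\<^sub>2 \<alpha> \<longlongrightarrow> l) (at_right 0) \<and>
       K2 \<gamma> (to_completion (alg_tensor L1 (holder_even \<gamma>)) (elem_tensor L1 (holder_even \<gamma>) \<phi>\<^sub>1 \<phi>\<^sub>2)) \<alpha>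
         = L1_integral \<phi>\<^sub>1 * (l /\<^sub>R pi))"
proof -
  let ?Y = "holder_even \<gamma> :: ('k, real \<Rightarrow> 'k) seminormed_space"
  let ?V = "alg_tensor L1 ?Y" and ?F = "extend_linearly L1 ?Y (K2_elem \<alpha>)"
  define N where "N = op_norm (holder_space \<gamma>) (holder_space \<gamma>)
    (hilbert_transform :: (real \<Rightarrow> 'k) \<Rightarrow> real \<Rightarrow> 'k)"
  have N: "0 \<le> N"
    unfolding N_def by (rule hilbert_op_norm_nonneg) fact+
  interpret seminormed_pair L1 ?Y
  proof (intro seminormed_pair.intro seminormed_pair_axioms.intro seminormed_vector_space_L1)
    show "0 \<le> seminorm ?Y \<phi>" if "\<phi> \<in> vcarrier ?Y" for \<phi>
      using holder_periodic.M_nonneg[OF holder_space_holder_periodic[OF _ assms(2,3)]] that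
      by (auto simp: holder_even_simps)
  qed
  note b = bilinear_form_K2_elem[OF assms(2,3), of \<alpha>, where 'k = 'k]
  interpret functional_on_seminormed_space ?V ?F "N * pi powr \<gamma>"
  proof (intro functional_on_seminormed_space.intro functional_on_seminormed_space_axioms.intro
      seminormed_vector_space_alg_tensor functional_bound_alg_tensor b)
    show "norm (K2_elem \<alpha> A \<phi>) \<le> N * pi powr \<gamma> * (seminorm L1 A * seminorm ?Y \<phi>)"
      if "A \<in> vcarrier L1" "\<phi> \<in> vcarrier ?Y" for A \<phi>
      unfolding N_def by (rule norm_K2_elem_le[OF that assms(2,3)])
  qed (use N in simp_all)
  have K2: "(\<lambda>\<phi>. K2 \<gamma> \<phi> \<alpha>) = extend_by_continuity ?F"
    by (simp add: K2_def fun_eq_iff)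
  have E: "E = sn_completion ?V"
    by (simp add: E_def proj_tensor_def)
  \<comment> \<open>The empty list represents the zero tensor, so the carrier is nonempty.\<close>
  have "(\<lambda>_. 0) \<in> vcarrier ?V"
    unfolding carrier_alg_tensor by (rule exI[of _ "[]"]) (simp add: represents_def)
  then have "op_norm E scalars (\<lambda>\<phi>. K2 \<gamma> \<phi> \<alpha>) \<le> N * pi powr \<gamma>"
    unfolding E K2 by (rule op_norm_completion_le)
  also have "\<dots> \<le> N * (2 * pi) powr \<gamma>"
    using N assms(2) by (intro mult_left_mono powr_mono2) auto
  also have "\<dots> \<le> inverse \<gamma> * pi powr (\<gamma> - 1) + N * (2 * pi) powr \<gamma>"
    using assms(2) by simp
  finally have "op_norm E scalars (\<lambda>\<phi>. K2 \<gamma> \<phi> \<alpha>) \<le> inverse \<gamma> * pi powr (\<gamma> - 1) + N * (2 * pi) powr \<gamma>" .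
  moreover have "bounded_linear_functional E (\<lambda>\<phi>. K2 \<gamma> \<phi> \<alpha>)"
    unfolding E K2 by (rule functional_bound_imp_bounded_linear[OF functional_bound_completion])
  \<comment> \<open>Here the abstract extension is tied to the concrete formula: the principal value
    is a genuine limit, and the value on an embedded elementary tensor is the prescribed
    product.\<close>
  moreover have "\<exists>l :: 'k. (truncated_sin_integral \<phi>\<^sub>2 \<alpha> \<longlongrightarrow> l) (at_right 0) \<and>
      K2 \<gamma> (to_completion ?V (elem_tensor L1 ?Y \<phi>\<^sub>1 \<phi>\<^sub>2)) \<alpha> = L1_integral \<phi>\<^sub>1 * (l /\<^sub>R pi)"
    if "\<phi>\<^sub>1 \<in> vcarrier L1" "\<phi>\<^sub>2 \<in> vcarrier ?Y" for \<phi>\<^sub>1 \<phi>\<^sub>2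
  proof -
    have phi: "\<phi>\<^sub>2 \<in> vcarrier (holder_space \<gamma>)"
      using that(2) by (simp add: holder_even_simps)
    have u: "elem_tensor L1 ?Y \<phi>\<^sub>1 \<phi>\<^sub>2 \<in> vcarrier ?V"
      using represents_elem_tensor[OF that] carrier_alg_tensor by blast
    have "K2 \<gamma> (to_completion ?V (elem_tensor L1 ?Y \<phi>\<^sub>1 \<phi>\<^sub>2)) \<alpha> = K2_elem \<alpha> \<phi>\<^sub>1 \<phi>\<^sub>2"
      by (simp add: K2_def extend_by_continuity_to_completion[OF u] extend_linearly_eq[OF b u])
        (simp add: elem_tensor_def b)
    then show ?thesis
      using truncated_sin_integral_tendsto[OF holder_space_holder_periodic[OF phi assms(2,3)], of \<alpha>]
      by (intro exI conjI) (auto simp: K2_elem_eq[OF phi assms(2,3)])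
  qed
  ultimately show ?thesis
    unfolding N_def by blast
qed

end
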